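(* Let $(X,b)$ be a connected symmetric weighted graph with weight $\mu\colon X\to(0,\infty)$, and assume that $(X,b,\mu)$ satisfies the finiteness condition (FC), i.e. for every $x\in X$ the function $y\mapsto b(x,y)/\mu(y)$ belongs to $\ell^2_\mu(X)$. Assume that there exists an intrinsic pseudo metric $\rho$ for $(X,b,\mu)$ such that condition (B* ) holds, i.e. for every $o\in X$ and every $r\geq 0$ the weighted vertex degree $\operatorname{Deg}$ is bounded on the ball $B(o,r)=\{y\in X\colon \rho(o,y)\leq r\}$. Let $V\colon X\to\mathbb{R}$ satisfy $V=U-W$, where $U,W\colon X\to\mathbb{R}$ are functions with $U(x)\geq 0$ and $W(x)\geq 0$ for all $x\in X$. Assume additionally that there exist constants $c_1\geq 0$ and $c_2\geq 0$ such that $$|\nabla W|^2(x)\leq c_1+c_2W(x)\quad\text{for all } x\in X.$$ Then the operator $\mathcal{L}_V|_{C_c(X)}$ is essentially self-adjoint in $\ell^2_\mu(X)$.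
   Context: A symmetric weighted graph $(X,b)$ consists of a countable nonempty set $X$ (vertices) and a function $b\colon X\times X\to[0,\infty)$ with $b(x,y)=b(y,x)$ for all $x,y\in X$, $b(x,x)=0$ for all $x\in X$, and $\sum_{z\in X}b(x,z)<\infty$ for all $x\in X$. The graph is not assumed to be locally finite. Write $x\sim y$ if $b(x,y)>0$. The graph is connected if any two vertices $x,y$ can be joined by a finite path, i.e. a finite sequence of vertices $x=x_0,x_1,\dots,x_n=y$ with $x_j\sim x_{j+1}$ for $0\leq j\leq n-1$. $C(X)$ is the set of all functions $f\colon X\to\mathbb{C}$ and $C_c(X)$ is the set of finitely supported functions in $C(X)$. For a weight $\mu\colon X\to(0,\infty)$, $\ell^2_\mu(X)$ is the Hilbert space of $f\in C(X)$ with $\sum_{x\in X}\mu(x)|f(x)|^2<\infty$, with inner product $(f,g)=\sum_{x\in X}\mu(x)f(x)\overline{g(x)}$. Weighted vertex degree: $\operatorname{Deg}(x)=\frac{1}{\mu(x)}\sum_{y\in X}b(x,y)$. Squared gradient of $f\in C(X)$: $|\nabla f|^2(x)=\frac{1}{\mu(x)}\sum_{y\in X}b(x,y)|f(x)-f(y)|^2$. A pseudo metric is a symmetric map $\rho\colon X\times X\to[0,\infty)$ with $\rho(x,x)=0$ for all $x\in X$ that satisfies the triangle inequality. It is called intrinsic for $(X,b,\mu)$ if $\sum_{y\in X}b(x,y)(\rho(x,y))^2\leq\mu(x)$ for all $x\in X$. For $V\colon X\to\mathbb{R}$, the formal discrete Schrödinger operator $\mathcal{L}_V\colon\mathcal{F}\to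 C(X)$ has domain $\mathcal{F}=\{f\in C(X)\colon \sum_{y\in X}b(x,y)|f(y)|<\infty\text{ for all }x\in X\}$ and acts by $$\mathcal{L}_Vf(x)=\frac{1}{\mu(x)}\sum_{y\in X}b(x,y)(f(x)-f(y))+V(x)f(x),\quad x\in X.$$ Condition (FC) is equivalent to $\mathcal{L}_V[C_c(X)]\subseteq\ell^2_\mu(X)$, so under (FC) the restriction $\mathcal{L}_V|_{C_c(X)}$ is regarded as an operator in $\ell^2_\mu(X)$ with domain $C_c(X)$; it is symmetric. *)

theory Defs
  imports "HOL-Analysis.Analysis"
begin

section \<open>Weighted graphs\<close>

text \<open>
  The countable nonempty vertex set is a type of class \<^class>\<open>countable\<close>.
\<close>

definition weighted_graph :: "('a::countable \<Rightarrow> 'a \<Rightarrow> real) \<Rightarrow> bool" where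
  "weighted_graph b \<longleftrightarrow>
     (\<forall>x y. 0 \<le> b x y) \<and> (\<forall>x y. b x y = b y x) \<and> (\<forall>x. b x x = 0) \<and>
     (\<forall>x. (\<lambda>z. b x z) summable_on UNIV)"

definition adjacent :: "('a \<Rightarrow> 'a \<Rightarrow> real) \<Rightarrow> 'a \<Rightarrow> 'a \<Rightarrow> bool" where
  "adjacent b x y \<longleftrightarrow> b x y > 0"

definition connected_graph :: "('a \<Rightarrow> 'a \<Rightarrow> real) \<Rightarrow> bool" where
  "connected_graph b \<longleftrightarrow> (\<forall>x y. (adjacent b)\<^sup>*\<^sup>* x y)"

definition weighted_degree :: "('a \<Rightarrow> 'a \<Rightarrow> real) \<Rightarrow> ('a \<Rightarrow> real) \<Rightarrow> 'a \<Rightarrow> real" where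
  "weighted_degree b \<mu> x = 1 / \<mu> x * (\<Sum>\<^sub>\<infinity>y. b x y)"

text \<open>
  The squared gradient of an arbitrary function may be infinite, so it takes values in
  \<^typ>\<open>ennreal\<close>; a real-valued \<^const>\<open>infsum\<close> would be \<open>0\<close> for a divergent sum.
  The same applies to the sum in \<open>intrinsic\<close> below.
\<close>

definition grad_sq ::
  "('a \<Rightarrow> 'a \<Rightarrow> real) \<Rightarrow> ('a \<Rightarrow> real) \<Rightarrow> ('a \<Rightarrow> complex) \<Rightarrow> 'a \<Rightarrow> ennreal" where
  "grad_sq b \<mu> f x =
     ennreal (1 / \<mu> x) * (\<Sum>\<^sub>\<infinity>y. ennreal (b x y * (cmod (f x - f y))\<^sup>2))"

definition pseudo_metric :: "('a \<Rightarrow> 'a \<Rightarrow> real) \<Rightarrow> bool" where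
  "pseudo_metric \<rho> \<longleftrightarrow>
     (\<forall>x y. 0 \<le> \<rho> x y) \<and> (\<forall>x. \<rho> x x = 0) \<and> (\<forall>x y. \<rho> x y = \<rho> y x) \<and>
     (\<forall>x y z. \<rho> x z \<le> \<rho> x y + \<rho> y z)"

definition intrinsic ::
  "('a \<Rightarrow> 'a \<Rightarrow> real) \<Rightarrow> ('a \<Rightarrow> real) \<Rightarrow> ('a \<Rightarrow> 'a \<Rightarrow> real) \<Rightarrow> bool" where
  "intrinsic b \<mu> \<rho> \<longleftrightarrow>
     (\<forall>x. (\<Sum>\<^sub>\<infinity>y. ennreal (b x y * (\<rho> x y)\<^sup>2)) \<le> ennreal (\<mu> x))"

definition metric_ball :: "('a \<Rightarrow> 'a \<Rightarrow> real) \<Rightarrow> 'a \<Rightarrow> real \<Rightarrow> 'a set" where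
  "metric_ball \<rho> x0 r = {y. \<rho> x0 y \<le> r}"

definition degree_bounded_on_balls ::
  "('a \<Rightarrow> 'a \<Rightarrow> real) \<Rightarrow> ('a \<Rightarrow> real) \<Rightarrow> ('a \<Rightarrow> 'a \<Rightarrow> real) \<Rightarrow> bool" where
  "degree_bounded_on_balls b \<mu> \<rho> \<longleftrightarrow>
     (\<forall>x0. \<forall>r\<ge>0. bounded (weighted_degree b \<mu> ` metric_ball \<rho> x0 r))"


section \<open>The weighted space of square summable functions\<close>

definition finsupp_funs :: "('a \<Rightarrow> complex) set" where
  "finsupp_funs = {f. finite {x. f x \<noteq> 0}}"

definition l2 :: "('a \<Rightarrow> real) \<Rightarrow> ('a \<Rightarrow> complex) set" where
  "l2 \<mu> = {f. (\<lambda>x. \<mu> x * (cmod (f x))\<^sup>2) summable_on UNIV}"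

definition l2_inner :: "('a \<Rightarrow> real) \<Rightarrow> ('a \<Rightarrow> complex) \<Rightarrow> ('a \<Rightarrow> complex) \<Rightarrow> complex" where
  "l2_inner \<mu> f g = (\<Sum>\<^sub>\<infinity>x. complex_of_real (\<mu> x) * f x * cnj (g x))"

definition l2_norm :: "('a \<Rightarrow> real) \<Rightarrow> ('a \<Rightarrow> complex) \<Rightarrow> real" where
  "l2_norm \<mu> f = sqrt (\<Sum>\<^sub>\<infinity>x. \<mu> x * (cmod (f x))\<^sup>2)"

definition finiteness_condition :: "('a \<Rightarrow> 'a \<Rightarrow> real) \<Rightarrow> ('a \<Rightarrow> real) \<Rightarrow> bool" where
  "finiteness_condition b \<mu> \<longleftrightarrow> (\<forall>x. (\<lambda>y. complex_of_real (b x y / \<mu> y)) \<in> l2 \<mu>)"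


section \<open>Unbounded operators\<close>

text \<open>
  An operator in the weighted space is identified with its graph, a set of pairs of functions;
  its domain is \<^const>\<open>Domain\<close> of that set.
\<close>

type_synonym 'a op_graph = "(('a \<Rightarrow> complex) \<times> ('a \<Rightarrow> complex)) set"

definition restrict_op ::
  "(('a \<Rightarrow> complex) \<Rightarrow> ('a \<Rightarrow> complex)) \<Rightarrow> ('a \<Rightarrow> complex) set \<Rightarrow> 'a op_graph" where
  "restrict_op A D = {(f, A f) | f. f \<in> D}"

definition l2_operator :: "('a \<Rightarrow> real) \<Rightarrow> 'a op_graph \<Rightarrow> bool" where
  "l2_operator \<mu> T \<longleftrightarrow>
     T \<subseteq> l2 \<mu> \<times> l2 \<mu> \<and> single_valued T \<and>
     ((\<lambda>x. 0), (\<lambda>x. 0)) \<in> T \<and>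
     (\<forall>f f' g g'. \<forall>c d :: complex. (f, f') \<in> T \<longrightarrow> (g, g') \<in> T \<longrightarrow>
        ((\<lambda>x. c * f x + d * g x), (\<lambda>x. c * f' x + d * g' x)) \<in> T)"

definition densely_defined :: "('a \<Rightarrow> real) \<Rightarrow> 'a op_graph \<Rightarrow> bool" where
  "densely_defined \<mu> T \<longleftrightarrow>
     (\<forall>f\<in>l2 \<mu>. \<forall>e>0. \<exists>g\<in>Domain T. l2_norm \<mu> (\<lambda>x. f x - g x) < e)"

definition symmetric_operator :: "('a \<Rightarrow> real) \<Rightarrow> 'a op_graph \<Rightarrow> bool" where
  "symmetric_operator \<mu> T \<longleftrightarrow>
     l2_operator \<mu> T \<and> densely_defined \<mu> T \<and>
     (\<forall>(f, f')\<in>T. \<forall>(g, g')\<in>T. l2_inner \<mu> f' g = l2_inner \<mu> f g')"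

definition adjoint_op :: "('a \<Rightarrow> real) \<Rightarrow> 'a op_graph \<Rightarrow> 'a op_graph" where
  "adjoint_op \<mu> T =
     {(g, h). g \<in> l2 \<mu> \<and> h \<in> l2 \<mu> \<and> (\<forall>(f, f')\<in>T. l2_inner \<mu> f' g = l2_inner \<mu> f h)}"

definition self_adjoint :: "('a \<Rightarrow> real) \<Rightarrow> 'a op_graph \<Rightarrow> bool" where
  "self_adjoint \<mu> T \<longleftrightarrow> l2_operator \<mu> T \<and> densely_defined \<mu> T \<and> adjoint_op \<mu> T = T"

definition closure_op :: "('a \<Rightarrow> real) \<Rightarrow> 'a op_graph \<Rightarrow> 'a op_graph" where
  "closure_op \<mu> T =
     {(f, g). f \<in> l2 \<mu> \<and> g \<in> l2 \<mu> \<and>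
        (\<exists>u v. (\<forall>n::nat. (u n, v n) \<in> T) \<and>
           (\<lambda>n. l2_norm \<mu> (\<lambda>x. u n x - f x)) \<longlonglongrightarrow> 0 \<and>
           (\<lambda>n. l2_norm \<mu> (\<lambda>x. v n x - g x)) \<longlonglongrightarrow> 0)}"

text \<open>
  Essentially self-adjoint: symmetric with self-adjoint closure. Closability is contained in
  \<^const>\<open>self_adjoint\<close>, which asks the closed graph to be single-valued.
\<close>

definition essentially_self_adjoint :: "('a \<Rightarrow> real) \<Rightarrow> 'a op_graph \<Rightarrow> bool" where
  "essentially_self_adjoint \<mu> T \<longleftrightarrow> symmetric_operator \<mu> T \<and> self_adjoint \<mu> (closure_op \<mu> T)"


section \<open>Discrete Schroedinger operators\<close>

text \<open>
  The formal operator is defined on the functions \<open>f\<close> for which all the sums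
  \<open>\<Sum>y. b x y * cmod (f y)\<close> are finite, so that the series below converges absolutely. As a HOL
  function it is total; its values off this domain are irrelevant. The domain contains all
  finitely supported functions.
\<close>

definition formal_domain :: "('a \<Rightarrow> 'a \<Rightarrow> real) \<Rightarrow> ('a \<Rightarrow> complex) set" where
  "formal_domain b = {f. \<forall>x. (\<lambda>y. b x y * cmod (f y)) summable_on UNIV}"

definition schroedinger ::
  "('a \<Rightarrow> 'a \<Rightarrow> real) \<Rightarrow> ('a \<Rightarrow> real) \<Rightarrow> ('a \<Rightarrow> real) \<Rightarrow> ('a \<Rightarrow> complex) \<Rightarrow> 'a \<Rightarrow> complex" where
  "schroedinger b \<mu> V f x =
     complex_of_real (1 / \<mu> x) * (\<Sum>\<^sub>\<infinity>y. complex_of_real (b x y) * (f x - f y))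
       + complex_of_real (V x) * f x"

lemma finsupp_funs_subset_formal_domain: "finsupp_funs \<subseteq> formal_domain b"
proof
  fix f :: "'a \<Rightarrow> complex"
  assume "f \<in> finsupp_funs"
  then have fin: "finite {y. f y \<noteq> 0}"
    by (simp add: finsupp_funs_def)
  have "(\<lambda>y. b x y * cmod (f y)) summable_on UNIV" for x
  proof -
    have "(\<lambda>y. b x y * cmod (f y)) summable_on {y. f y \<noteq> 0}"
      using fin by simp
    then show ?thesis
      by (rule summable_on_cong_neutral[THEN iffD1, rotated -1]) auto
  qed
  then show "f \<in> formal_domain b"
    by (simp add: formal_domain_def)
qed

end

theory Submission
  imports Defs
begin

text \<open>
The operator is symmetric, so by von Neumann's criterion (\<open>essentially_self_adjointI\<close>) it suffices that
a square summable \<open>u\<close> on which the adjoint acts as multiplication by \<open>\<kappa>\<close>, with \<open>\<kappa> = \<i>\<close> or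
\<open>\<kappa> = - \<i>\<close>, vanishes. By the finiteness condition such a \<open>u\<close> solves the pointwise equation
\<open>schroedinger b \<mu> V u = \<kappa> * u\<close> (\<open>adjoint_schroedinger\<close>).

The hypotheses on the metric \<open>\<rho>\<close> and on the potential \<open>W\<close> merge into a single function,
\<open>Q x = sqrt (1 + W x) + \<rho> z x\<close> with a base point \<open>z\<close>. The gradient bound on \<open>W\<close> implies that
\<open>sqrt (1 + W)\<close> has energy at most a multiple of \<open>\<mu>\<close>; for \<open>\<rho>\<close> this is the property of being intrinsic. So the sum
\<open>\<Sum>y. b x y * (Q x - Q y)^2\<close> is at most \<open>K * \<mu> x\<close>; moreover \<open>- V \<le> Q^2\<close>, and the degree is bounded on the
sublevel sets of \<open>Q\<close>. The conditions on \<open>Q\<close> and on the degree make up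
the locale \<open>exhausted_graph\<close>.

They allow a Sears type argument. Testing the equation with \<open>Q^(-2) * cnj u\<close> and taking real parts bounds the
energy of \<open>u\<close> with weight \<open>Q^(-2)\<close> by the squared norm of \<open>u\<close> (\<open>weighted_energy\<close>): the weight absorbs the
negative part of \<open>V\<close>. Testing with a cut-off times \<open>cnj u\<close> and
taking imaginary parts bounds the localized squared norm by a commutator term. The cut-off is
\<open>1 - ln Q / n\<close>, truncated at \<open>0\<close>; its gradient is at most that of \<open>Q\<close>, divided by \<open>n * Q\<close>, so the commutator is
controlled by the weighted energy and is of order \<open>1 / n\<close> (\<open>log_cut_mass_le\<close>). Letting \<open>n\<close> grow gives \<open>u = 0\<close>.

The sublevel sets of \<open>Q\<close> may be infinite, so the cut-off functions are not finitely supported.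
Green's formula still applies to them, because the edges that leave a sublevel set are either short, with bounded
degree at the outer vertex, or long, with total weight controlled by the energy of \<open>Q\<close>
(\<open>sublevel_mass\<close>).
\<close>

section \<open>The weighted space as a Hilbert space\<close>

lemma nonneg_summable_of_bounded_sums:
  fixes f :: "'b \<Rightarrow> real"
  assumes "\<And>x. 0 \<le> f x" and "\<And>F. finite F \<Longrightarrow> sum f F \<le> c"
  shows "f summable_on UNIV" and "infsum f UNIV \<le> c"
proof -
  show sm: "f summable_on UNIV"
    by (rule nonneg_bdd_above_summable_on) (use assms in \<open>auto intro!: bdd_aboveI2\<close>)
  show "infsum f UNIV \<le> c"
    by (rule infsum_le_finite_sums[OF sm]) (use assms in auto)
qed

locale weight =
  fixes \<mu> :: "'a \<Rightarrow> real"
  assumes pos: "0 < \<mu> x"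
begin

abbreviation l2_partial :: "('a \<Rightarrow> complex) \<Rightarrow> 'a set \<Rightarrow> real" where
  "l2_partial f F \<equiv> L2_set (\<lambda>x. sqrt (\<mu> x) * cmod (f x)) F"

lemma l2_partial_eq: "l2_partial f F = sqrt (\<Sum>x\<in>F. \<mu> x * (cmod (f x))\<^sup>2)"
  unfolding L2_set_def using pos by (simp add: power_mult_distrib less_imp_le)

lemma l2_norm_nonneg [simp]: "0 \<le> l2_norm \<mu> f"
  unfolding l2_norm_def by (intro real_sqrt_ge_zero infsum_nonneg) (simp add: pos less_imp_le)

lemma l2_norm_square: "(l2_norm \<mu> f)\<^sup>2 = (\<Sum>\<^sub>\<infinity>x. \<mu> x * (cmod (f x))\<^sup>2)"
  unfolding l2_norm_def
  by (intro real_sqrt_pow2 infsum_nonneg) (simp add: pos less_imp_le)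

lemma l2_partial_le_norm:
  assumes "f \<in> l2 \<mu>" "finite F"
  shows "l2_partial f F \<le> l2_norm \<mu> f"
  unfolding l2_partial_eq l2_norm_def
  by (intro real_sqrt_le_mono finite_sum_le_infsum)
     (use assms in \<open>auto simp: l2_def pos less_imp_le\<close>)

text \<open>Membership and norm bounds can be checked on finite sets. This transfers the triangle
  inequality from \<^const>\<open>L2_set\<close>, and it is the Fatou argument in the proof of completeness: a bound
  on finite sets survives pointwise limits.\<close>
lemma l2I:
  assumes "\<And>F. finite F \<Longrightarrow> l2_partial f F \<le> c"
  shows "f \<in> l2 \<mu>" and "l2_norm \<mu> f \<le> c"
proof -
  have c: "0 \<le> c" using assms[of "{}"] by simp
  have le: "(\<Sum>x\<in>F. \<mu> x * (cmod (f x))\<^sup>2) \<le> c\<^sup>2" if "finite F" for F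
    using assms[OF that] c unfolding l2_partial_eq by (simp add: real_le_lsqrt sqrt_le_D)
  show "f \<in> l2 \<mu>" unfolding l2_def
    using nonneg_summable_of_bounded_sums(1)[OF _ le] pos by (auto simp: less_imp_le)
  have "(\<Sum>\<^sub>\<infinity>x. \<mu> x * (cmod (f x))\<^sup>2) \<le> c\<^sup>2"
    using nonneg_summable_of_bounded_sums(2)[OF _ le] pos by (auto simp: less_imp_le)
  then show "l2_norm \<mu> f \<le> c" unfolding l2_norm_def by (simp add: c real_le_lsqrt)
qed

lemma
  assumes "f \<in> l2 \<mu>" "g \<in> l2 \<mu>"
  shows l2_add: "(\<lambda>x. f x + g x) \<in> l2 \<mu>"
    and l2_triangle: "l2_norm \<mu> (\<lambda>x. f x + g x) \<le> l2_norm \<mu> f + l2_norm \<mu> g"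
proof -
  have le: "l2_partial (\<lambda>x. f x + g x) F \<le> l2_norm \<mu> f + l2_norm \<mu> g" if "finite F" for F
  proof -
    have "l2_partial (\<lambda>x. f x + g x) F
        \<le> L2_set (\<lambda>x. sqrt (\<mu> x) * cmod (f x) + sqrt (\<mu> x) * cmod (g x)) F"
      using pos by (intro L2_set_mono)
        (auto simp flip: distrib_left intro!: mult_left_mono norm_triangle_ineq simp: less_imp_le)
    also have "\<dots> \<le> l2_partial f F + l2_partial g F" by (rule L2_set_triangle_ineq)
    also have "\<dots> \<le> l2_norm \<mu> f + l2_norm \<mu> g"
      by (intro add_mono l2_partial_le_norm assms that)
    finally show ?thesis .
  qed
  from l2I[OF le] show "(\<lambda>x. f x + g x) \<in> l2 \<mu>"
    and "l2_norm \<mu> (\<lambda>x. f x + g x) \<le> l2_norm \<mu> f + l2_norm \<mu> g" by auto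
qed

lemma l2_norm_scale: "l2_norm \<mu> (\<lambda>x. c * f x) = cmod c * l2_norm \<mu> f"
proof -
  have "(\<Sum>\<^sub>\<infinity>x. \<mu> x * (cmod (c * f x))\<^sup>2) = (cmod c)\<^sup>2 * (\<Sum>\<^sub>\<infinity>x. \<mu> x * (cmod (f x))\<^sup>2)"
    by (simp add: norm_mult power_mult_distrib ac_simps flip: infsum_cmult_right')
  then show ?thesis unfolding l2_norm_def by (simp add: real_sqrt_mult)
qed

lemma l2_scale: "f \<in> l2 \<mu> \<Longrightarrow> (\<lambda>x. c * f x) \<in> l2 \<mu>"
  unfolding l2_def mem_Collect_eq
  by (drule summable_on_cmult_right[of _ _ "(cmod c)\<^sup>2"])
     (simp add: norm_mult power_mult_distrib ac_simps)

lemma l2_zero [simp]: "(\<lambda>x. 0) \<in> l2 \<mu>"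
  unfolding l2_def by simp

lemma l2_lincomb: "f \<in> l2 \<mu> \<Longrightarrow> g \<in> l2 \<mu> \<Longrightarrow> (\<lambda>x. c * f x + d * g x) \<in> l2 \<mu>"
  by (intro l2_add l2_scale)

lemma l2_diff: "f \<in> l2 \<mu> \<Longrightarrow> g \<in> l2 \<mu> \<Longrightarrow> (\<lambda>x. f x - g x) \<in> l2 \<mu>"
  using l2_lincomb[of f g 1 "-1"] by simp

lemma l2_norm_minus_commute: "l2_norm \<mu> (\<lambda>x. f x - g x) = l2_norm \<mu> (\<lambda>x. g x - f x)"
  unfolding l2_norm_def by (simp add: norm_minus_commute)

lemma l2_pointwise_le:
  assumes "f \<in> l2 \<mu>" shows "sqrt (\<mu> x) * cmod (f x) \<le> l2_norm \<mu> f"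
  using l2_partial_le_norm[OF assms, of "{x}"] pos[of x] by (simp add: less_imp_le)

lemma l2_norm_eq_0D:
  assumes "f \<in> l2 \<mu>" "l2_norm \<mu> f = 0" shows "f x = 0"
  using l2_pointwise_le[OF assms(1), of x] assms(2) pos[of x]
  by (simp add: mult_le_0_iff)

lemma l2_inner_abs_summable:
  assumes "f \<in> l2 \<mu>" "g \<in> l2 \<mu>"
  shows "(\<lambda>x. cmod (complex_of_real (\<mu> x) * f x * cnj (g x))) summable_on UNIV"
    and "(\<Sum>\<^sub>\<infinity>x. cmod (complex_of_real (\<mu> x) * f x * cnj (g x))) \<le> l2_norm \<mu> f * l2_norm \<mu> g"
proof -
  have le: "(\<Sum>x\<in>F. cmod (complex_of_real (\<mu> x) * f x * cnj (g x))) \<le> l2_norm \<mu> f * l2_norm \<mu> g"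
    if "finite F" for F
  proof -
    have "cmod (complex_of_real (\<mu> x) * f x * cnj (g x))
        = \<bar>sqrt (\<mu> x) * cmod (f x)\<bar> * \<bar>sqrt (\<mu> x) * cmod (g x)\<bar>" for x
      using pos[of x] by (simp add: norm_mult abs_mult less_imp_le algebra_simps)
    then have "(\<Sum>x\<in>F. cmod (complex_of_real (\<mu> x) * f x * cnj (g x))) \<le> l2_partial f F * l2_partial g F"
      using L2_set_mult_ineq by simp
    also have "\<dots> \<le> l2_norm \<mu> f * l2_norm \<mu> g"
      by (intro mult_mono l2_partial_le_norm assms that) auto
    finally show ?thesis .
  qed
  show "(\<lambda>x. cmod (complex_of_real (\<mu> x) * f x * cnj (g x))) summable_on UNIV"
    "(\<Sum>\<^sub>\<infinity>x. cmod (complex_of_real (\<mu> x) * f x * cnj (g x))) \<le> l2_norm \<mu> f * l2_norm \<mu> g"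
    by (rule nonneg_summable_of_bounded_sums[OF _ le]; simp)+
qed

lemma l2_inner_summable:
  "f \<in> l2 \<mu> \<Longrightarrow> g \<in> l2 \<mu> \<Longrightarrow> (\<lambda>x. complex_of_real (\<mu> x) * f x * cnj (g x)) summable_on UNIV"
  by (rule abs_summable_summable) (rule l2_inner_abs_summable)

lemma l2_cauchy_schwarz:
  assumes "f \<in> l2 \<mu>" "g \<in> l2 \<mu>"
  shows "cmod (l2_inner \<mu> f g) \<le> l2_norm \<mu> f * l2_norm \<mu> g"
  unfolding l2_inner_def
  using norm_infsum_bound[OF l2_inner_abs_summable(1)[OF assms]] l2_inner_abs_summable(2)[OF assms]
  by linarith

lemma l2_inner_cnj: "cnj (l2_inner \<mu> f g) = l2_inner \<mu> g f"
  unfolding l2_inner_def by (simp flip: infsum_cnj add: ac_simps)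

lemma l2_inner_lincomb_left:
  assumes "f \<in> l2 \<mu>" "g \<in> l2 \<mu>" "h \<in> l2 \<mu>"
  shows "l2_inner \<mu> (\<lambda>x. c * f x + d * g x) h = c * l2_inner \<mu> f h + d * l2_inner \<mu> g h"
proof -
  have "l2_inner \<mu> (\<lambda>x. c * f x + d * g x) h
     = (\<Sum>\<^sub>\<infinity>x. c * (complex_of_real (\<mu> x) * f x * cnj (h x)) + d * (complex_of_real (\<mu> x) * g x * cnj (h x)))"
    unfolding l2_inner_def by (simp add: algebra_simps)
  also have "\<dots> = c * l2_inner \<mu> f h + d * l2_inner \<mu> g h"
    unfolding l2_inner_def
    by (subst infsum_add) (auto intro!: summable_on_cmult_right l2_inner_summable assms simp: infsum_cmult_right')
  finally show ?thesis .
qed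

lemma l2_inner_lincomb_right:
  assumes "f \<in> l2 \<mu>" "g \<in> l2 \<mu>" "h \<in> l2 \<mu>"
  shows "l2_inner \<mu> h (\<lambda>x. c * f x + d * g x) = cnj c * l2_inner \<mu> h f + cnj d * l2_inner \<mu> h g"
  using arg_cong[OF l2_inner_lincomb_left[OF assms, of c d], of cnj] by (simp add: l2_inner_cnj)

lemma l2_inner_self:
  assumes "f \<in> l2 \<mu>"
  shows "l2_inner \<mu> f f = complex_of_real ((l2_norm \<mu> f)\<^sup>2)"
proof -
  have "complex_of_real (\<mu> x) * f x * cnj (f x) = complex_of_real (\<mu> x * (cmod (f x))\<^sup>2)" for x
    by (simp add: complex_norm_square[symmetric] mult.assoc del: of_real_power)
  then show ?thesis unfolding l2_inner_def l2_norm_square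
    using assms by (simp del: of_real_mult of_real_power add: l2_def infsumI[OF has_sum_of_real[OF has_sum_infsum]])
qed

lemma l2_norm_square_lincomb:
  assumes "f \<in> l2 \<mu>" "g \<in> l2 \<mu>"
  shows "(l2_norm \<mu> (\<lambda>x. f x - c * g x))\<^sup>2
    = (l2_norm \<mu> f)\<^sup>2 - 2 * Re (c * l2_inner \<mu> g f) + (cmod c)\<^sup>2 * (l2_norm \<mu> g)\<^sup>2"
proof -
  let ?k = "\<lambda>x. 1 * f x + (- c) * g x"
  have k: "?k \<in> l2 \<mu>" by (intro l2_lincomb assms)
  have "complex_of_real ((l2_norm \<mu> ?k)\<^sup>2) = l2_inner \<mu> ?k ?k" by (simp only: l2_inner_self[OF k])
  also have "\<dots> = l2_inner \<mu> f f - (c * l2_inner \<mu> g f + cnj (c * l2_inner \<mu> g f)) + c * cnj c * l2_inner \<mu> g g"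
    unfolding l2_inner_lincomb_left[OF assms k] l2_inner_lincomb_right[OF assms assms(1)]
      l2_inner_lincomb_right[OF assms assms(2)]
    by (simp add: algebra_simps l2_inner_cnj)
  also have "\<dots> = complex_of_real ((l2_norm \<mu> f)\<^sup>2 - 2 * Re (c * l2_inner \<mu> g f) + (cmod c)\<^sup>2 * (l2_norm \<mu> g)\<^sup>2)"
    unfolding l2_inner_self[OF assms(1)] l2_inner_self[OF assms(2)] complex_add_cnj complex_norm_square[symmetric] by simp
  finally have "(l2_norm \<mu> ?k)\<^sup>2 = (l2_norm \<mu> f)\<^sup>2 - 2 * Re (c * l2_inner \<mu> g f) + (cmod c)\<^sup>2 * (l2_norm \<mu> g)\<^sup>2"
    using of_real_eq_iff by blast
  then show ?thesis by simp
qed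

lemma l2_parallelogram:
  assumes "f \<in> l2 \<mu>" "g \<in> l2 \<mu>"
  shows "(l2_norm \<mu> (\<lambda>x. f x + g x))\<^sup>2 + (l2_norm \<mu> (\<lambda>x. f x - g x))\<^sup>2
    = 2 * (l2_norm \<mu> f)\<^sup>2 + 2 * (l2_norm \<mu> g)\<^sup>2"
  using l2_norm_square_lincomb[OF assms, of 1] l2_norm_square_lincomb[OF assms, of "-1"] by simp

lemma l2_inner_tendsto_left:
  assumes "\<And>n. u n \<in> l2 \<mu>" "v \<in> l2 \<mu>" "g \<in> l2 \<mu>"
    and "(\<lambda>n. l2_norm \<mu> (\<lambda>x. u n x - v x)) \<longlonglongrightarrow> 0"
  shows "(\<lambda>n. l2_inner \<mu> (u n) g) \<longlonglongrightarrow> l2_inner \<mu> v g"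
proof -
  have "(\<lambda>n. l2_norm \<mu> (\<lambda>x. u n x - v x) * l2_norm \<mu> g) \<longlonglongrightarrow> 0"
    using tendsto_mult_right[OF assms(4), of "l2_norm \<mu> g"] by simp
  moreover have "cmod (l2_inner \<mu> (u n) g - l2_inner \<mu> v g) \<le> l2_norm \<mu> (\<lambda>x. u n x - v x) * l2_norm \<mu> g" for n
    using l2_inner_lincomb_left[OF assms(1)[of n] assms(2,3), of 1 "-1"]
      l2_cauchy_schwarz[OF l2_diff[OF assms(1)[of n] assms(2)] assms(3)] by simp
  ultimately have "(\<lambda>n. l2_inner \<mu> (u n) g - l2_inner \<mu> v g) \<longlonglongrightarrow> 0"
    by (intro Lim_null_comparison[where f="\<lambda>n. l2_inner \<mu> (u n) g - l2_inner \<mu> v g"] always_eventually) auto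
  then show ?thesis by (simp add: LIM_zero_iff)
qed

text \<open>A Cauchy sequence converges pointwise because every point has positive weight, and the
Cauchy bound passes to the pointwise limit on finite sets.\<close>
lemma l2_complete:
  assumes mem: "\<And>n. r n \<in> l2 \<mu>"
    and cauchy: "\<And>e. e > 0 \<Longrightarrow> \<exists>N. \<forall>m\<ge>N. \<forall>n\<ge>N. l2_norm \<mu> (\<lambda>x. r m x - r n x) \<le> e"
  obtains w where "w \<in> l2 \<mu>" "(\<lambda>n. l2_norm \<mu> (\<lambda>x. r n x - w x)) \<longlonglongrightarrow> 0"
proof -
  have "Cauchy (\<lambda>n. r n x)" for x
  proof (rule metric_CauchyI)
    fix e :: real assume e: "e > 0"
    have s: "sqrt (\<mu> x) > 0" using pos by simp
    obtain N where N: "\<And>m n. m \<ge> N \<Longrightarrow> n \<ge> N \<Longrightarrow> l2_norm \<mu> (\<lambda>x. r m x - r n x) \<le> sqrt (\<mu> x) * (e / 2)"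
      using cauchy[of "sqrt (\<mu> x) * (e / 2)"] e s by auto
    show "\<exists>M. \<forall>m\<ge>M. \<forall>n\<ge>M. dist (r m x) (r n x) < e"
    proof (intro exI[of _ N] allI impI)
      fix m n assume "m \<ge> N" "n \<ge> N"
      then have "sqrt (\<mu> x) * cmod (r m x - r n x) \<le> sqrt (\<mu> x) * (e / 2)"
        using l2_pointwise_le[OF l2_diff[OF mem[of m] mem[of n]], of x] N by force
      then have "cmod (r m x - r n x) \<le> e / 2" using s by simp
      then show "dist (r m x) (r n x) < e" using e by (simp add: dist_norm)
    qed
  qed
  then have "\<exists>w. \<forall>x. (\<lambda>n. r n x) \<longlonglongrightarrow> w x"
    by (intro choice) (simp add: Cauchy_convergent_iff convergent_def)
  then obtain w where w: "\<And>x. (\<lambda>n. r n x) \<longlonglongrightarrow> w x" by blast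
  have close: "\<exists>N. \<forall>n\<ge>N. (\<lambda>x. r n x - w x) \<in> l2 \<mu> \<and> l2_norm \<mu> (\<lambda>x. r n x - w x) \<le> e" if e: "e > 0" for e
  proof -
    obtain N where N: "\<And>m n. m \<ge> N \<Longrightarrow> n \<ge> N \<Longrightarrow> l2_norm \<mu> (\<lambda>x. r m x - r n x) \<le> e"
      using cauchy[OF e] by blast
    have "l2_partial (\<lambda>x. r n x - w x) F \<le> e" if n: "n \<ge> N" and F: "finite F" for n F
    proof (rule LIMSEQ_le_const2)
      show "(\<lambda>m. l2_partial (\<lambda>x. r n x - r m x) F) \<longlonglongrightarrow> l2_partial (\<lambda>x. r n x - w x) F"
        unfolding L2_set_def by (intro tendsto_intros w)
      show "\<exists>M. \<forall>m\<ge>M. l2_partial (\<lambda>x. r n x - r m x) F \<le> e"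
        using l2_partial_le_norm[OF l2_diff[OF mem[of n] mem] F] N n by (meson order_trans)
    qed
    from l2I[OF this] show ?thesis by blast
  qed
  obtain N where "(\<lambda>x. r N x - w x) \<in> l2 \<mu>" using close[of 1] by auto
  from l2_diff[OF mem[of N] this] have "w \<in> l2 \<mu>" by simp
  moreover have "(\<lambda>n. l2_norm \<mu> (\<lambda>x. r n x - w x)) \<longlonglongrightarrow> 0"
  proof (rule LIMSEQ_I)
    fix e :: real assume "e > 0"
    then show "\<exists>N. \<forall>n\<ge>N. norm (l2_norm \<mu> (\<lambda>x. r n x - w x) - 0) < e"
      using close[of "e/2"] by (force intro: le_less_trans)
  qed
  ultimately show ?thesis using that by blast
qed

text \<open>The orthogonal projection onto the closure of a subspace \<open>M\<close>. The parallelogram law makes a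
minimizing sequence for the distance from \<open>k\<close> to \<open>M\<close> Cauchy; the residual in the limit is still minimal
under perturbation along \<open>M\<close>, so its first variation vanishes.\<close>
lemma l2_projection:
  assumes sub: "M \<subseteq> l2 \<mu>" and zero: "(\<lambda>x. 0) \<in> M"
    and lin: "\<And>f g c d. f \<in> M \<Longrightarrow> g \<in> M \<Longrightarrow> (\<lambda>x. c * f x + d * g x) \<in> M"
    and k: "k \<in> l2 \<mu>"
  obtains w m where "w \<in> l2 \<mu>" "\<And>n::nat. m n \<in> M"
    "(\<lambda>n. l2_norm \<mu> (\<lambda>x. (k x - m n x) - w x)) \<longlonglongrightarrow> 0" "\<And>g. g \<in> M \<Longrightarrow> l2_inner \<mu> g w = 0"
proof -
  define S where "S = (\<lambda>f. (l2_norm \<mu> (\<lambda>x. k x - f x))\<^sup>2) ` M"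
  define d where "d = Inf S"
  have bdd: "bdd_below S" unfolding S_def by (rule bdd_belowI2[where m=0]) simp
  have ne: "S \<noteq> {}" using zero S_def by auto
  have d_le: "d \<le> (l2_norm \<mu> (\<lambda>x. k x - f x))\<^sup>2" if "f \<in> M" for f
    unfolding d_def by (rule cInf_lower[OF _ bdd]) (use that S_def in auto)
  have "\<exists>f\<in>M. (l2_norm \<mu> (\<lambda>x. k x - f x))\<^sup>2 < d + 1 / Suc n" for n
    using cInf_lessD[OF ne, of "d + 1 / Suc n"] unfolding d_def S_def by auto
  then obtain m where mM: "\<And>n. m n \<in> M" and m: "\<And>n. (l2_norm \<mu> (\<lambda>x. k x - m n x))\<^sup>2 < d + 1 / Suc n"
    by metis
  have ml: "m n \<in> l2 \<mu>" for n using mM sub by auto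
  define r where "r n = (\<lambda>x. k x - m n x)" for n
  have rl: "r n \<in> l2 \<mu>" for n unfolding r_def by (intro l2_diff k ml)
  have par: "(l2_norm \<mu> (\<lambda>x. r i x - r j x))\<^sup>2 \<le> 2 / Suc i + 2 / Suc j" for i j
  proof -
    have "(\<lambda>x. (1/2) * m i x + (1/2) * m j x) \<in> M" by (intro lin mM)
    from d_le[OF this] have "4 * d \<le> (2 * l2_norm \<mu> (\<lambda>x. k x - ((1/2) * m i x + (1/2) * m j x)))\<^sup>2"
      by (simp add: power_mult_distrib)
    also have "2 * l2_norm \<mu> (\<lambda>x. k x - ((1/2) * m i x + (1/2) * m j x)) = l2_norm \<mu> (\<lambda>x. r i x + r j x)"
      using l2_norm_scale[of 2 "\<lambda>x. k x - ((1/2) * m i x + (1/2) * m j x)"]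
      by (simp add: r_def algebra_simps)
    finally show ?thesis
      using l2_parallelogram[OF rl[of i] rl[of j]] m[of i] m[of j] by (simp add: r_def)
  qed
  have cauchy: "\<exists>N. \<forall>i\<ge>N. \<forall>j\<ge>N. l2_norm \<mu> (\<lambda>x. r i x - r j x) \<le> e" if e: "e > 0" for e
  proof -
    obtain N where N: "1 / Suc N < e\<^sup>2 / 4" using nat_approx_posE[of "e\<^sup>2/4"] e by auto
    show "\<exists>N. \<forall>i\<ge>N. \<forall>j\<ge>N. l2_norm \<mu> (\<lambda>x. r i x - r j x) \<le> e"
    proof (intro exI[of _ N] allI impI)
      fix i j assume ij: "i \<ge> N" "j \<ge> N"
      have "1 / real (Suc i) \<le> 1 / Suc N" "1 / real (Suc j) \<le> 1 / Suc N"
        using ij by (auto simp: field_simps)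
      then have "(l2_norm \<mu> (\<lambda>x. r i x - r j x))\<^sup>2 \<le> e\<^sup>2" using par[of i j] N by simp
      then show "l2_norm \<mu> (\<lambda>x. r i x - r j x) \<le> e" 
        by (rule power2_le_imp_le) (use e in simp)
    qed
  qed
  obtain w where w: "w \<in> l2 \<mu>" and wlim: "(\<lambda>n. l2_norm \<mu> (\<lambda>x. r n x - w x)) \<longlonglongrightarrow> 0"
    by (rule l2_complete[of r, OF rl cauchy])
  have "l2_inner \<mu> g w = 0" if g: "g \<in> M" for g
  proof (rule ccontr)
    assume a0: "l2_inner \<mu> g w \<noteq> 0"
    have gl: "g \<in> l2 \<mu>" using g sub by auto
    define a where "a = cmod (l2_inner \<mu> g w)"
    have a: "a > 0" using a0 a_def by simp
    \<comment> \<open>The limit inherits the minimality of the sequence along every direction \<open>g\<close>.\<close>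
    have min: "l2_norm \<mu> w \<le> l2_norm \<mu> (\<lambda>x. w x - c * g x)" for c
    proof -
      have dl: "d \<le> (l2_norm \<mu> (\<lambda>x. w x - c * g x) + l2_norm \<mu> (\<lambda>x. r n x - w x))\<^sup>2" for n
      proof -
        have "(\<lambda>x. 1 * m n x + c * g x) \<in> M" by (intro lin mM g)
        from d_le[OF this] have "d \<le> (l2_norm \<mu> (\<lambda>x. (w x - c * g x) + (r n x - w x)))\<^sup>2"
          by (simp add: r_def algebra_simps)
        also have "\<dots> \<le> (l2_norm \<mu> (\<lambda>x. w x - c * g x) + l2_norm \<mu> (\<lambda>x. r n x - w x))\<^sup>2"
          by (intro power_mono l2_triangle l2_diff w rl l2_scale gl) auto
        finally show ?thesis .
      qed
      have "(\<lambda>n. (l2_norm \<mu> (\<lambda>x. w x - c * g x) + l2_norm \<mu> (\<lambda>x. r n x - w x))\<^sup>2)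
         \<longlonglongrightarrow> (l2_norm \<mu> (\<lambda>x. w x - c * g x) + 0)\<^sup>2" by (intro tendsto_intros wlim)
      from LIMSEQ_le_const[OF this] dl have 1: "d \<le> (l2_norm \<mu> (\<lambda>x. w x - c * g x))\<^sup>2" by auto
      have rn: "(\<lambda>n. l2_norm \<mu> (\<lambda>x. r n x - w x) + sqrt (d + 1 / Suc n)) \<longlonglongrightarrow> 0 + sqrt (d + 0)"
        by (intro tendsto_intros wlim LIMSEQ_Suc[OF lim_1_over_n])
      have "l2_norm \<mu> w \<le> l2_norm \<mu> (\<lambda>x. r n x - w x) + sqrt (d + 1 / Suc n)" for n
      proof -
        have "l2_norm \<mu> w \<le> l2_norm \<mu> (\<lambda>x. w x - r n x) + l2_norm \<mu> (r n)"
          using l2_triangle[OF l2_diff[OF w rl[of n]] rl[of n]] by simp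
        moreover have "l2_norm \<mu> (r n) \<le> sqrt (d + 1 / Suc n)"
          using m[of n] by (intro real_le_rsqrt) (simp add: r_def less_imp_le)
        ultimately show ?thesis by (simp add: l2_norm_minus_commute)
      qed
      with LIMSEQ_le_const[OF rn] have "l2_norm \<mu> w \<le> sqrt d" by auto
      also have "\<dots> \<le> l2_norm \<mu> (\<lambda>x. w x - c * g x)" using 1 by (simp add: real_le_lsqrt)
      finally show ?thesis .
    qed
    (* A step c in the direction of the inner product changes the squared norm by
       -2 t a^2 + t^2 a^2 |g|^2; this t makes the first-order term dominate. *)
    define t where "t = 1 / ((l2_norm \<mu> g)\<^sup>2 + 1)"
    have t: "t > 0" "t * (l2_norm \<mu> g)\<^sup>2 \<le> 1"
      unfolding t_def by (auto simp: field_simps add_pos_nonneg add_nonneg_pos)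
    define c where "c = complex_of_real t * cnj (l2_inner \<mu> g w)"
    have "c * l2_inner \<mu> g w = complex_of_real (t * a\<^sup>2)"
      unfolding c_def a_def by (simp add: complex_norm_square algebra_simps del: of_real_power)
    moreover have "cmod c = t * a" unfolding c_def a_def using t by (simp add: norm_mult)
    ultimately have "(l2_norm \<mu> (\<lambda>x. w x - c * g x))\<^sup>2
        = (l2_norm \<mu> w)\<^sup>2 - 2 * (t * a\<^sup>2) + (t * a)\<^sup>2 * (l2_norm \<mu> g)\<^sup>2"
      using l2_norm_square_lincomb[OF w gl, of c] by simp
    moreover have "(l2_norm \<mu> w)\<^sup>2 \<le> (l2_norm \<mu> (\<lambda>x. w x - c * g x))\<^sup>2"
      by (intro power_mono min) auto
    ultimately have "2 * (t * a\<^sup>2) \<le> (t * a\<^sup>2) * (t * (l2_norm \<mu> g)\<^sup>2)"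
      by (simp add: power2_eq_square algebra_simps)
    also have "\<dots> \<le> (t * a\<^sup>2) * 1" using t by (intro mult_left_mono) auto
    finally show False using t a by simp
  qed
  from that[OF w mM wlim[unfolded r_def] this] show ?thesis .
qed

end

section \<open>A criterion for essential self-adjointness\<close>

lemma has_sum_sum_type:
  fixes F :: "'b + 'c \<Rightarrow> 'd::{topological_comm_monoid_add}"
  assumes "((\<lambda>x. F (Inl x)) has_sum s) UNIV" "((\<lambda>x. F (Inr x)) has_sum t) UNIV"
  shows "(F has_sum (s + t)) UNIV"
proof -
  have "(F has_sum s) (range Inl)" "(F has_sum t) (range Inr)"
    using assms by (simp_all add: has_sum_reindex o_def)
  then have "(F has_sum (s + t)) (range Inl \<union> range Inr)"
    by (rule has_sum_Un_disjoint) auto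
  then show ?thesis by (simp add: UNIV_sum)
qed

context weight
begin

text \<open>Pairs of square summable functions are functions on the sum type \<^typ>\<open>'a + 'a\<close>, weighted by
\<^term>\<open>case_sum \<mu> \<mu>\<close>. In this way the projection of a single function also provides the projection onto
the closure of the graph of an operator.\<close>
lemma weight_sum: "weight (case_sum \<mu> \<mu>)"
  by unfold_locales (simp split: sum.split add: pos)

lemma l2_sum_weight:
  "k \<in> l2 (case_sum \<mu> \<mu>) \<longleftrightarrow> (\<lambda>x. k (Inl x)) \<in> l2 \<mu> \<and> (\<lambda>x. k (Inr x)) \<in> l2 \<mu>"
proof
  assume "k \<in> l2 (case_sum \<mu> \<mu>)"
  then have *: "(\<lambda>x. case_sum \<mu> \<mu> x * (cmod (k x))\<^sup>2) summable_on UNIV" by (simp add: l2_def)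
  have "(\<lambda>x. case_sum \<mu> \<mu> x * (cmod (k x))\<^sup>2) summable_on range Inl"
    "(\<lambda>x. case_sum \<mu> \<mu> x * (cmod (k x))\<^sup>2) summable_on range Inr"
    by (rule summable_on_subset_banach[OF *]; simp)+
  then show "(\<lambda>x. k (Inl x)) \<in> l2 \<mu> \<and> (\<lambda>x. k (Inr x)) \<in> l2 \<mu>"
    by (simp add: summable_on_reindex o_def l2_def)
next
  assume "(\<lambda>x. k (Inl x)) \<in> l2 \<mu> \<and> (\<lambda>x. k (Inr x)) \<in> l2 \<mu>"
  then show "k \<in> l2 (case_sum \<mu> \<mu>)"
    unfolding l2_def mem_Collect_eq summable_iff_has_sum_infsum[of _ "UNIV :: 'a set"]
    using has_sum_sum_type[of "\<lambda>x. case_sum \<mu> \<mu> x * (cmod (k x))\<^sup>2"]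
    by (auto simp: summable_on_def)
qed

lemma
  assumes "(\<lambda>x. k (Inl x)) \<in> l2 \<mu>" "(\<lambda>x. k (Inr x)) \<in> l2 \<mu>"
  shows l2_norm_sum_weight_left: "l2_norm \<mu> (\<lambda>x. k (Inl x)) \<le> l2_norm (case_sum \<mu> \<mu>) k"
    and l2_norm_sum_weight_right: "l2_norm \<mu> (\<lambda>x. k (Inr x)) \<le> l2_norm (case_sum \<mu> \<mu>) k"
proof -
  interpret S: weight "case_sum \<mu> \<mu>" by (rule weight_sum)
  have "(l2_norm (case_sum \<mu> \<mu>) k)\<^sup>2
      = (l2_norm \<mu> (\<lambda>x. k (Inl x)))\<^sup>2 + (l2_norm \<mu> (\<lambda>x. k (Inr x)))\<^sup>2"
    unfolding S.l2_norm_square l2_norm_square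
    by (intro infsumI has_sum_sum_type) (use assms in \<open>auto simp: l2_def\<close>)
  then have "(l2_norm \<mu> (\<lambda>x. k (Inl x)))\<^sup>2 \<le> (l2_norm (case_sum \<mu> \<mu>) k)\<^sup>2"
    "(l2_norm \<mu> (\<lambda>x. k (Inr x)))\<^sup>2 \<le> (l2_norm (case_sum \<mu> \<mu>) k)\<^sup>2" by simp_all
  then show "l2_norm \<mu> (\<lambda>x. k (Inl x)) \<le> l2_norm (case_sum \<mu> \<mu>) k"
    "l2_norm \<mu> (\<lambda>x. k (Inr x)) \<le> l2_norm (case_sum \<mu> \<mu>) k"
    using S.l2_norm_nonneg power2_le_imp_le by blast+
qed

lemma l2_inner_sum_weight:
  assumes "f \<in> l2 \<mu>" "f' \<in> l2 \<mu>" "(\<lambda>x. k (Inl x)) \<in> l2 \<mu>" "(\<lambda>x. k (Inr x)) \<in> l2 \<mu>"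
  shows "l2_inner (case_sum \<mu> \<mu>) (case_sum f f') k
    = l2_inner \<mu> f (\<lambda>x. k (Inl x)) + l2_inner \<mu> f' (\<lambda>x. k (Inr x))"
  unfolding l2_inner_def
  using has_sum_infsum[OF l2_inner_summable[OF assms(1,3)]] has_sum_infsum[OF l2_inner_summable[OF assms(2,4)]]
  by (intro infsumI has_sum_sum_type) simp_all

lemma adjoint_opI:
  assumes "g \<in> l2 \<mu>" "h \<in> l2 \<mu>"
    and "\<And>f f'. (f, f') \<in> T \<Longrightarrow> l2_inner \<mu> f' g = l2_inner \<mu> f h"
  shows "(g, h) \<in> adjoint_op \<mu> T"
  using assms by (auto simp: adjoint_op_def)

lemma adjoint_opD:
  assumes "(g, h) \<in> adjoint_op \<mu> T"
  shows "g \<in> l2 \<mu>" "h \<in> l2 \<mu>" "(f, f') \<in> T \<Longrightarrow> l2_inner \<mu> f' g = l2_inner \<mu> f h"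
  using assms by (auto simp: adjoint_op_def)

lemma adjoint_lincomb:
  assumes T: "T \<subseteq> l2 \<mu> \<times> l2 \<mu>" and "(f, f') \<in> adjoint_op \<mu> T" "(g, g') \<in> adjoint_op \<mu> T"
  shows "((\<lambda>x. c * f x + d * g x), (\<lambda>x. c * f' x + d * g' x)) \<in> adjoint_op \<mu> T"
proof -
  have l: "f \<in> l2 \<mu>" "f' \<in> l2 \<mu>" "g \<in> l2 \<mu>" "g' \<in> l2 \<mu>"
    using assms by (auto simp: adjoint_op_def)
  have "l2_inner \<mu> e' (\<lambda>x. c * f x + d * g x) = l2_inner \<mu> e (\<lambda>x. c * f' x + d * g' x)"
    if "(e, e') \<in> T" for e e'
  proof -
    have e: "e \<in> l2 \<mu>" "e' \<in> l2 \<mu>" using that T by auto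
    show ?thesis
      unfolding l2_inner_lincomb_right[OF l(1,3) e(2)] l2_inner_lincomb_right[OF l(2,4) e(1)]
      by (simp only: adjoint_opD(3)[OF assms(2) that] adjoint_opD(3)[OF assms(3) that])
  qed
  then show ?thesis using l by (intro adjoint_opI l2_lincomb)
qed

lemma adjoint_single_valued:
  assumes T: "T \<subseteq> l2 \<mu> \<times> l2 \<mu>" and dense: "densely_defined \<mu> T"
  shows "single_valued (adjoint_op \<mu> T)"
proof (rule single_valuedI)
  fix g h h' assume gh: "(g, h) \<in> adjoint_op \<mu> T" "(g, h') \<in> adjoint_op \<mu> T"
  define k where "k = (\<lambda>x. h x - h' x)"
  have hl: "h \<in> l2 \<mu>" "h' \<in> l2 \<mu>" using gh by (auto simp: adjoint_op_def)
  then have k: "k \<in> l2 \<mu>" unfolding k_def by (rule l2_diff)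
  have orth: "l2_inner \<mu> f k = 0" if "f \<in> Domain T" for f
  proof -
    obtain f' where "(f, f') \<in> T" using \<open>f \<in> Domain T\<close> by blast
    then have f: "f \<in> l2 \<mu>" and "l2_inner \<mu> f h = l2_inner \<mu> f h'"
      using T adjoint_opD(3)[OF gh(1)] adjoint_opD(3)[OF gh(2)] by auto
    then show ?thesis using l2_inner_lincomb_right[OF hl f, of 1 "-1"] by (simp add: k_def)
  qed
  have "l2_norm \<mu> k \<le> 0 + e" if e: "e > 0" for e
  proof -
    obtain f where f: "f \<in> Domain T" "l2_norm \<mu> (\<lambda>x. k x - f x) < e"
      using dense k e unfolding densely_defined_def by blast
    then have fl: "f \<in> l2 \<mu>" using T by auto
    have "complex_of_real ((l2_norm \<mu> k)\<^sup>2) = l2_inner \<mu> (\<lambda>x. k x - f x) k"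
      using l2_inner_lincomb_left[OF k fl k, of 1 "-1"] orth[OF f(1)] l2_inner_self[OF k] by simp
    then have "(l2_norm \<mu> k)\<^sup>2 = cmod (l2_inner \<mu> (\<lambda>x. k x - f x) k)"
      by (metis abs_of_nonneg norm_of_real zero_le_power2)
    also have "\<dots> \<le> l2_norm \<mu> (\<lambda>x. k x - f x) * l2_norm \<mu> k"
      by (intro l2_cauchy_schwarz l2_diff k fl)
    also have "\<dots> \<le> e * l2_norm \<mu> k" using f(2) by (intro mult_right_mono) auto
    finally have "l2_norm \<mu> k * l2_norm \<mu> k \<le> e * l2_norm \<mu> k" by (simp add: power2_eq_square)
    then show ?thesis using e l2_norm_nonneg[of k] by (cases "l2_norm \<mu> k = 0") auto
  qed
  then have "l2_norm \<mu> k \<le> 0" by (rule field_le_epsilon)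
  then have "l2_norm \<mu> k = 0" using l2_norm_nonneg[of k] by linarith
  then show "h = h'" using l2_norm_eq_0D[OF k] by (auto simp: k_def)
qed

lemma l2_inner_tendsto_right:
  assumes "\<And>n. u n \<in> l2 \<mu>" "v \<in> l2 \<mu>" "g \<in> l2 \<mu>"
    and "(\<lambda>n. l2_norm \<mu> (\<lambda>x. u n x - v x)) \<longlonglongrightarrow> 0"
  shows "(\<lambda>n. l2_inner \<mu> g (u n)) \<longlonglongrightarrow> l2_inner \<mu> g v"
  using tendsto_cnj[OF l2_inner_tendsto_left[OF assms]] by (simp add: l2_inner_cnj)

lemma closure_opE:
  assumes "(f, f') \<in> closure_op \<mu> T" "T \<subseteq> l2 \<mu> \<times> l2 \<mu>"
  obtains u v where "f \<in> l2 \<mu>" "f' \<in> l2 \<mu>" "\<And>n. (u n, v n) \<in> T" "\<And>n. u n \<in> l2 \<mu>" "\<And>n. v n \<in> l2 \<mu>"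
    "(\<lambda>n. l2_norm \<mu> (\<lambda>x. u n x - f x)) \<longlonglongrightarrow> 0" "(\<lambda>n. l2_norm \<mu> (\<lambda>x. v n x - f' x)) \<longlonglongrightarrow> 0"
  using assms unfolding closure_op_def by blast

lemma closure_op_superset: "T \<subseteq> l2 \<mu> \<times> l2 \<mu> \<Longrightarrow> T \<subseteq> closure_op \<mu> T"
proof -
  assume T: "T \<subseteq> l2 \<mu> \<times> l2 \<mu>"
  have 0: "l2_norm \<mu> (\<lambda>x. 0) = 0" by (simp add: l2_norm_def)
  have "(f, f') \<in> closure_op \<mu> T" if "(f, f') \<in> T" for f f'
    unfolding closure_op_def mem_Collect_eq prod.case
    using T that by (intro conjI exI[of _ "\<lambda>_. f"] exI[of _ "\<lambda>_. f'"]) (auto simp: 0)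
  then show ?thesis by auto
qed

lemma adjoint_op_closure:
  assumes T: "T \<subseteq> l2 \<mu> \<times> l2 \<mu>"
  shows "adjoint_op \<mu> (closure_op \<mu> T) = adjoint_op \<mu> T"
proof
  show "adjoint_op \<mu> (closure_op \<mu> T) \<subseteq> adjoint_op \<mu> T"
    using closure_op_superset[OF T] unfolding adjoint_op_def by blast
next
  have "l2_inner \<mu> f' g = l2_inner \<mu> f h"
    if gh: "(g, h) \<in> adjoint_op \<mu> T" and ff: "(f, f') \<in> closure_op \<mu> T" for f f' g h
  proof -
    have l: "g \<in> l2 \<mu>" "h \<in> l2 \<mu>" using gh by (auto simp: adjoint_op_def)
    obtain u v where uv: "f \<in> l2 \<mu>" "f' \<in> l2 \<mu>" "\<And>n. (u n, v n) \<in> T" "\<And>n. u n \<in> l2 \<mu>" "\<And>n. v n \<in> l2 \<mu>"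
      "(\<lambda>n. l2_norm \<mu> (\<lambda>x. u n x - f x)) \<longlonglongrightarrow> 0" "(\<lambda>n. l2_norm \<mu> (\<lambda>x. v n x - f' x)) \<longlonglongrightarrow> 0"
      using closure_opE[OF ff T] by blast
    have "(\<lambda>n. l2_inner \<mu> (v n) g) \<longlonglongrightarrow> l2_inner \<mu> f' g"
      by (rule l2_inner_tendsto_left[OF uv(5,2) l(1) uv(7)])
    moreover have "l2_inner \<mu> (v n) g = l2_inner \<mu> (u n) h" for n
      by (rule adjoint_opD(3)[OF gh uv(3)])
    moreover have "(\<lambda>n. l2_inner \<mu> (u n) h) \<longlonglongrightarrow> l2_inner \<mu> f h"
      by (rule l2_inner_tendsto_left[OF uv(4,1) l(2) uv(6)])
    ultimately show ?thesis using LIMSEQ_unique by simp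
  qed
  then show "adjoint_op \<mu> T \<subseteq> adjoint_op \<mu> (closure_op \<mu> T)"
    by (auto intro!: adjoint_opI dest: adjoint_opD(1,2))
qed

lemma closure_op_subset_adjoint:
  assumes sym: "symmetric_operator \<mu> T"
  shows "closure_op \<mu> T \<subseteq> adjoint_op \<mu> T"
proof -
  have T: "T \<subseteq> l2 \<mu> \<times> l2 \<mu>" using sym by (simp add: symmetric_operator_def l2_operator_def)
  have eq: "l2_inner \<mu> e' f = l2_inner \<mu> e f'" if ff: "(f, f') \<in> closure_op \<mu> T" and ee: "(e, e') \<in> T" for e e' f f'
  proof -
    have l: "e \<in> l2 \<mu>" "e' \<in> l2 \<mu>" using ee T by auto
    obtain u v where uv: "f \<in> l2 \<mu>" "f' \<in> l2 \<mu>" "\<And>n. (u n, v n) \<in> T" "\<And>n. u n \<in> l2 \<mu>" "\<And>n. v n \<in> l2 \<mu>"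
      "(\<lambda>n. l2_norm \<mu> (\<lambda>x. u n x - f x)) \<longlonglongrightarrow> 0" "(\<lambda>n. l2_norm \<mu> (\<lambda>x. v n x - f' x)) \<longlonglongrightarrow> 0"
      using closure_opE[OF ff T] by blast
    have "(\<lambda>n. l2_inner \<mu> e' (u n)) \<longlonglongrightarrow> l2_inner \<mu> e' f"
      by (rule l2_inner_tendsto_right[OF uv(4,1) l(2) uv(6)])
    moreover have "l2_inner \<mu> e' (u n) = l2_inner \<mu> e (v n)" for n
      using sym uv(3)[of n] ee by (auto simp: symmetric_operator_def)
    moreover have "(\<lambda>n. l2_inner \<mu> e (v n)) \<longlonglongrightarrow> l2_inner \<mu> e f'"
      by (rule l2_inner_tendsto_right[OF uv(5,2) l(1) uv(7)])
    ultimately show ?thesis using LIMSEQ_unique by simp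
  qed
  then show ?thesis using closure_opE[OF _ T] by (intro subrelI adjoint_opI) blast+
qed

lemma closure_op_lincomb:
  assumes T: "l2_operator \<mu> T" and ff: "(f, f') \<in> closure_op \<mu> T" and gg: "(g, g') \<in> closure_op \<mu> T"
  shows "((\<lambda>x. c * f x + d * g x), (\<lambda>x. c * f' x + d * g' x)) \<in> closure_op \<mu> T"
proof -
  have Tl: "T \<subseteq> l2 \<mu> \<times> l2 \<mu>" using T by (simp add: l2_operator_def)
  have lim: "(\<lambda>n. l2_norm \<mu> (\<lambda>x. (c * u n x + d * v n x) - (c * p x + d * q x))) \<longlonglongrightarrow> 0"
    if l: "\<And>n. u n \<in> l2 \<mu>" "\<And>n. v n \<in> l2 \<mu>" "p \<in> l2 \<mu>" "q \<in> l2 \<mu>"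
      and to: "(\<lambda>n. l2_norm \<mu> (\<lambda>x. u n x - p x)) \<longlonglongrightarrow> 0" "(\<lambda>n. l2_norm \<mu> (\<lambda>x. v n x - q x)) \<longlonglongrightarrow> 0"
    for u v :: "nat \<Rightarrow> 'a \<Rightarrow> complex" and p q
  proof (rule Lim_null_comparison[OF always_eventually])
    show "(\<lambda>n. cmod c * l2_norm \<mu> (\<lambda>x. u n x - p x) + cmod d * l2_norm \<mu> (\<lambda>x. v n x - q x)) \<longlonglongrightarrow> 0"
      using tendsto_add[OF tendsto_mult_left[OF to(1), of "cmod c"] tendsto_mult_left[OF to(2), of "cmod d"]]
      by simp
    show "\<forall>n. norm (l2_norm \<mu> (\<lambda>x. (c * u n x + d * v n x) - (c * p x + d * q x)))
       \<le> cmod c * l2_norm \<mu> (\<lambda>x. u n x - p x) + cmod d * l2_norm \<mu> (\<lambda>x. v n x - q x)"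
    proof
      fix n
      have "(\<lambda>x. (c * u n x + d * v n x) - (c * p x + d * q x)) = (\<lambda>x. c * (u n x - p x) + d * (v n x - q x))"
        by (simp add: algebra_simps)
      then show "norm (l2_norm \<mu> (\<lambda>x. (c * u n x + d * v n x) - (c * p x + d * q x)))
       \<le> cmod c * l2_norm \<mu> (\<lambda>x. u n x - p x) + cmod d * l2_norm \<mu> (\<lambda>x. v n x - q x)"
        using l2_triangle[OF l2_scale[OF l2_diff[OF l(1)[of n] l(3)], of c]
            l2_scale[OF l2_diff[OF l(2)[of n] l(4)], of d]]
        by (simp add: l2_norm_scale)
    qed
  qed
  obtain u v where uv: "f \<in> l2 \<mu>" "f' \<in> l2 \<mu>" "\<And>n. (u n, v n) \<in> T" "\<And>n. u n \<in> l2 \<mu>" "\<And>n. v n \<in> l2 \<mu>"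
      "(\<lambda>n. l2_norm \<mu> (\<lambda>x. u n x - f x)) \<longlonglongrightarrow> 0" "(\<lambda>n. l2_norm \<mu> (\<lambda>x. v n x - f' x)) \<longlonglongrightarrow> 0"
    using closure_opE[OF ff Tl] by blast
  obtain r s where rs: "g \<in> l2 \<mu>" "g' \<in> l2 \<mu>" "\<And>n. (r n, s n) \<in> T" "\<And>n. r n \<in> l2 \<mu>" "\<And>n. s n \<in> l2 \<mu>"
      "(\<lambda>n. l2_norm \<mu> (\<lambda>x. r n x - g x)) \<longlonglongrightarrow> 0" "(\<lambda>n. l2_norm \<mu> (\<lambda>x. s n x - g' x)) \<longlonglongrightarrow> 0"
    using closure_opE[OF gg Tl] by blast
  have "((\<lambda>x. c * u n x + d * r n x), (\<lambda>x. c * v n x + d * s n x)) \<in> T" for n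
    using T uv(3)[of n] rs(3)[of n] unfolding l2_operator_def by blast
  then show ?thesis
    unfolding closure_op_def mem_Collect_eq prod.case
    using lim[OF uv(4) rs(4) uv(1) rs(1) uv(6) rs(6)] lim[OF uv(5) rs(5) uv(2) rs(2) uv(7) rs(7)]
    by (intro conjI exI[of _ "\<lambda>n x. c * u n x + d * r n x"] exI[of _ "\<lambda>n x. c * v n x + d * s n x"] allI)
       (auto intro: l2_lincomb uv rs)
qed

text \<open>A pair \<open>(g, h)\<close> in the adjoint is projected onto the graph of \<open>T\<close>. The residual \<open>(w1, w2)\<close> lies in
the adjoint, because the projected part lies in the closure of the symmetric operator. Orthogonality
to the graph says that \<open>(w2, - w1)\<close> lies in the adjoint as well. So the adjoint multiplies
\<open>w1 + \<i> * w2\<close> and \<open>w1 - \<i> * w2\<close> by \<open>- \<i>\<close> and \<open>\<i>\<close>, respectively; both vanish, and with them the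
residual.\<close>
lemma adjoint_subset_closure_op:
  assumes sym: "symmetric_operator \<mu> T"
    and deficiency: "\<And>u. (u, (\<lambda>x. \<i> * u x)) \<in> adjoint_op \<mu> T \<Longrightarrow> u = (\<lambda>x. 0)"
      "\<And>u. (u, (\<lambda>x. - \<i> * u x)) \<in> adjoint_op \<mu> T \<Longrightarrow> u = (\<lambda>x. 0)"
  shows "adjoint_op \<mu> T \<subseteq> closure_op \<mu> T"
proof (rule subrelI)
  fix g h assume gh: "(g, h) \<in> adjoint_op \<mu> T"
  then have l: "g \<in> l2 \<mu>" "h \<in> l2 \<mu>" by (auto simp: adjoint_op_def)
  interpret S: weight "case_sum \<mu> \<mu>" by (rule weight_sum)
  have op: "l2_operator \<mu> T" and T: "T \<subseteq> l2 \<mu> \<times> l2 \<mu>"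
    using sym by (auto simp: symmetric_operator_def l2_operator_def)
  define M where "M = (\<lambda>(f, f'). case_sum f f') ` T"
  obtain w m where w: "w \<in> l2 (case_sum \<mu> \<mu>)" and m: "\<And>n::nat. m n \<in> M"
    and lim: "(\<lambda>n. l2_norm (case_sum \<mu> \<mu>) (\<lambda>x. (case_sum g h x - m n x) - w x)) \<longlonglongrightarrow> 0"
    and orth: "\<And>f. f \<in> M \<Longrightarrow> l2_inner (case_sum \<mu> \<mu>) f w = 0"
  proof (rule S.l2_projection[of M "case_sum g h"])
    show "M \<subseteq> l2 (case_sum \<mu> \<mu>)" using T by (auto simp: M_def l2_sum_weight)
    show "(\<lambda>x. 0) \<in> M"
    proof -
      have "((\<lambda>x. 0), (\<lambda>x. 0)) \<in> T" using op by (simp add: l2_operator_def)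
      moreover have "(\<lambda>x. 0) = case_sum (\<lambda>x. 0) (\<lambda>x. 0)" by (auto split: sum.split)
      ultimately show ?thesis unfolding M_def by force
    qed
    show "(\<lambda>x. c * p x + d * q x) \<in> M" if pq: "p \<in> M" "q \<in> M" for p q c d
    proof -
      obtain f f' e e' where T2: "(f, f') \<in> T" "(e, e') \<in> T" and pq: "p = case_sum f f'" "q = case_sum e e'"
        using pq by (auto simp: M_def)
      have "((\<lambda>x. c * f x + d * e x), (\<lambda>x. c * f' x + d * e' x)) \<in> T"
        using op T2 unfolding l2_operator_def by blast
      moreover have "(\<lambda>x. c * p x + d * q x) = case_sum (\<lambda>x. c * f x + d * e x) (\<lambda>x. c * f' x + d * e' x)"
        unfolding pq by (auto split: sum.split)
      ultimately show ?thesis unfolding M_def by force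
    qed
    show "case_sum g h \<in> l2 (case_sum \<mu> \<mu>)" using l by (simp add: l2_sum_weight)
  qed (rule that)
  have "\<exists>f f'. (f, f') \<in> T \<and> m n = case_sum f f'" for n using m[of n] by (auto simp: M_def)
  then obtain u v where uv: "\<And>n. (u n, v n) \<in> T" and mn: "\<And>n. m n = case_sum (u n) (v n)" by metis
  define w1 w2 where "w1 = (\<lambda>x. w (Inl x))" and "w2 = (\<lambda>x. w (Inr x))"
  have wl: "w1 \<in> l2 \<mu>" "w2 \<in> l2 \<mu>" using w by (auto simp: l2_sum_weight w1_def w2_def)
  have uvl: "u n \<in> l2 \<mu>" "v n \<in> l2 \<mu>" for n using uv[of n] T by auto
  have residual: "(\<lambda>x. g x - u n x - w1 x) \<in> l2 \<mu>" "(\<lambda>x. h x - v n x - w2 x) \<in> l2 \<mu>" for n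
    by (intro l2_diff l wl uvl)+
  have "(\<lambda>n. l2_norm \<mu> (\<lambda>x. u n x - (g x - w1 x))) \<longlonglongrightarrow> 0"
  proof (rule Lim_null_comparison[OF always_eventually lim], rule)
    fix n
    have "l2_norm \<mu> (\<lambda>x. g x - u n x - w1 x) \<le> l2_norm (case_sum \<mu> \<mu>) (\<lambda>x. (case_sum g h x - m n x) - w x)"
      using l2_norm_sum_weight_left[of "\<lambda>x. (case_sum g h x - m n x) - w x"] residual[of n]
      by (simp add: mn w1_def w2_def)
    moreover have "(\<lambda>x. g x - u n x - w1 x) = (\<lambda>x. (g x - w1 x) - u n x)" by (simp add: algebra_simps)
    ultimately show "norm (l2_norm \<mu> (\<lambda>x. u n x - (g x - w1 x)))
      \<le> l2_norm (case_sum \<mu> \<mu>) (\<lambda>x. (case_sum g h x - m n x) - w x)"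
      by (subst l2_norm_minus_commute) simp
  qed
  moreover have "(\<lambda>n. l2_norm \<mu> (\<lambda>x. v n x - (h x - w2 x))) \<longlonglongrightarrow> 0"
  proof (rule Lim_null_comparison[OF always_eventually lim], rule)
    fix n
    have "l2_norm \<mu> (\<lambda>x. h x - v n x - w2 x) \<le> l2_norm (case_sum \<mu> \<mu>) (\<lambda>x. (case_sum g h x - m n x) - w x)"
      using l2_norm_sum_weight_right[of "\<lambda>x. (case_sum g h x - m n x) - w x"] residual[of n]
      by (simp add: mn w1_def w2_def)
    moreover have "(\<lambda>x. h x - v n x - w2 x) = (\<lambda>x. (h x - w2 x) - v n x)" by (simp add: algebra_simps)
    ultimately show "norm (l2_norm \<mu> (\<lambda>x. v n x - (h x - w2 x)))
      \<le> l2_norm (case_sum \<mu> \<mu>) (\<lambda>x. (case_sum g h x - m n x) - w x)"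
      by (subst l2_norm_minus_commute) simp
  qed
  ultimately have cl: "((\<lambda>x. g x - w1 x), (\<lambda>x. h x - w2 x)) \<in> closure_op \<mu> T"
    unfolding closure_op_def using uv l wl by (auto intro!: l2_diff)
  have w12: "(w1, w2) \<in> adjoint_op \<mu> T"
    using adjoint_lincomb[OF T gh subsetD[OF closure_op_subset_adjoint[OF sym] cl], of 1 "-1"] by simp
  have w21: "(w2, (\<lambda>x. - w1 x)) \<in> adjoint_op \<mu> T"
  proof -
    have "l2_inner \<mu> f' w2 = l2_inner \<mu> f (\<lambda>x. - w1 x)" if ff: "(f, f') \<in> T" for f f'
    proof -
      have fl: "f \<in> l2 \<mu>" "f' \<in> l2 \<mu>" using ff T by auto
      have "l2_inner \<mu> f w1 + l2_inner \<mu> f' w2 = 0"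
        using orth[of "case_sum f f'"] l2_inner_sum_weight[OF fl, of w] ff wl
        by (force simp: M_def w1_def w2_def)
      then show ?thesis
        using l2_inner_lincomb_right[OF wl(1) wl(1) fl(1), of 0 "-1"]
        by (simp add: add_eq_0_iff)
    qed
    then show ?thesis using wl l2_scale[OF wl(1), of "-1"] by (auto simp: adjoint_op_def)
  qed
  have "(\<lambda>x. w1 x + \<i> * w2 x) = (\<lambda>x. 0)"
    using adjoint_lincomb[OF T w12 w21, of 1 \<i>] by (intro deficiency(2)) (simp add: algebra_simps)
  moreover have "(\<lambda>x. w1 x - \<i> * w2 x) = (\<lambda>x. 0)"
    using adjoint_lincomb[OF T w12 w21, of 1 "-\<i>"] by (intro deficiency(1)) (simp add: algebra_simps)
  ultimately have "w1 x = 0 \<and> w2 x = 0" for x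
    by (auto dest!: fun_cong[of _ _ x] simp: add_eq_0_iff)
  then show "(g, h) \<in> closure_op \<mu> T" using cl by simp
qed

text \<open>Von Neumann's criterion, in the direction needed here: the closure equals the adjoint once both
deficiency spaces are trivial.\<close>
theorem essentially_self_adjointI:
  assumes sym: "symmetric_operator \<mu> T"
    and deficiency: "\<And>u. (u, (\<lambda>x. \<i> * u x)) \<in> adjoint_op \<mu> T \<Longrightarrow> u = (\<lambda>x. 0)"
      "\<And>u. (u, (\<lambda>x. - \<i> * u x)) \<in> adjoint_op \<mu> T \<Longrightarrow> u = (\<lambda>x. 0)"
  shows "essentially_self_adjoint \<mu> T"
proof -
  have op: "l2_operator \<mu> T" and T: "T \<subseteq> l2 \<mu> \<times> l2 \<mu>" and dense: "densely_defined \<mu> T"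
    using sym by (auto simp: symmetric_operator_def l2_operator_def)
  have cl: "closure_op \<mu> T = adjoint_op \<mu> T"
    using closure_op_subset_adjoint[OF sym] adjoint_subset_closure_op[OF assms] by blast
  have "l2_operator \<mu> (closure_op \<mu> T)"
    unfolding l2_operator_def
  proof (intro conjI allI impI)
    show "closure_op \<mu> T \<subseteq> l2 \<mu> \<times> l2 \<mu>" by (auto simp: closure_op_def)
    show "single_valued (closure_op \<mu> T)" unfolding cl by (rule adjoint_single_valued[OF T dense])
    show "((\<lambda>x. 0), (\<lambda>x. 0)) \<in> closure_op \<mu> T"
      using closure_op_superset[OF T] op by (auto simp: l2_operator_def)
  qed (rule closure_op_lincomb[OF op])
  moreover have "densely_defined \<mu> (closure_op \<mu> T)"
    using dense closure_op_superset[OF T] unfolding densely_defined_def by (meson Domain_mono subsetD)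
  moreover have "adjoint_op \<mu> (closure_op \<mu> T) = closure_op \<mu> T"
    using adjoint_op_closure[OF T] cl by simp
  ultimately show ?thesis using sym by (simp add: essentially_self_adjoint_def self_adjoint_def)
qed

end

section \<open>Double sums and Green's formula\<close>

lemma
  fixes f :: "'b \<Rightarrow> 'c \<Rightarrow> real"
  assumes nonneg: "\<And>x y. 0 \<le> f x y" and inner: "\<And>x. f x summable_on UNIV"
    and le: "\<And>x. infsum (f x) UNIV \<le> g x" and outer: "g summable_on UNIV"
  shows summable_on_pairsI: "(\<lambda>(x, y). f x y) summable_on UNIV"
    and infsum_pairs_le: "(\<Sum>\<^sub>\<infinity>(x, y). f x y) \<le> infsum g UNIV"
proof -
  have out: "(\<lambda>x. infsum (f x) UNIV) summable_on UNIV"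
    by (rule summable_on_comparison_test[OF outer]) (auto simp: le nonneg intro: infsum_nonneg)
  have "(\<lambda>(x, y). f x y) summable_on Sigma UNIV (\<lambda>_. UNIV)"
    by (rule summable_on_SigmaI[OF _ out]) (use nonneg inner in auto)
  then show *: "(\<lambda>(x, y). f x y) summable_on UNIV" by simp
  have "(\<Sum>\<^sub>\<infinity>(x, y). f x y) = (\<Sum>\<^sub>\<infinity>x. infsum (f x) UNIV)"
    using infsum_Sigma_banach[of "\<lambda>(x, y). f x y" UNIV "\<lambda>_. UNIV"] * by simp
  also have "\<dots> \<le> infsum g UNIV" by (rule infsum_mono[OF out outer le])
  finally show "(\<Sum>\<^sub>\<infinity>(x, y). f x y) \<le> infsum g UNIV" .
qed

lemma has_sum_pairs_swap:
  "((\<lambda>(x, y). f x y) has_sum s) UNIV \<Longrightarrow> ((\<lambda>(x, y). f y x) has_sum s) (UNIV :: ('b \<times> 'c) set)"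
  using has_sum_swap[of "\<lambda>(x, y). f x y" UNIV UNIV s] by simp

lemma summable_on_pairs_swap:
  "(\<lambda>(x, y). f x y) summable_on UNIV \<Longrightarrow> (\<lambda>(x, y). f y x) summable_on (UNIV :: ('b \<times> 'c) set)"
  unfolding summable_on_def using has_sum_pairs_swap by blast

lemma summable_on_pairs_finite_support:
  fixes h :: "'b \<Rightarrow> 'c \<Rightarrow> real"
  assumes "finite {x. f x \<noteq> (0::complex)}" "\<And>x y. 0 \<le> h x y" "\<And>x. h x summable_on UNIV"
  shows "(\<lambda>(x, y). h x y * cmod (f x)) summable_on UNIV"
proof (rule summable_on_pairsI)
  show "(\<lambda>x. infsum (h x) UNIV * cmod (f x)) summable_on UNIV"
    by (rule finite_nonzero_values_imp_summable_on) (use assms(1) in \<open>auto elim: finite_subset[rotated]\<close>)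
qed (use assms in \<open>auto simp: infsum_cmult_left' intro!: summable_on_cmult_left\<close>)

locale graph_space = weight \<mu> for \<mu> :: "'a::countable \<Rightarrow> real" +
  fixes b :: "'a \<Rightarrow> 'a \<Rightarrow> real"
  assumes graph: "weighted_graph b"
begin

lemma b_nonneg [simp]: "0 \<le> b x y" and b_sym: "b x y = b y x" and b_summable: "b x summable_on UNIV"
  using graph by (auto simp: weighted_graph_def)

definition deg :: "'a \<Rightarrow> real" where
  "deg x = infsum (b x) UNIV"

definition lap :: "('a \<Rightarrow> complex) \<Rightarrow> 'a \<Rightarrow> complex" where
  "lap u x = (\<Sum>\<^sub>\<infinity>y. complex_of_real (b x y) * (u x - u y))"

lemma mu_schroedinger:
  "complex_of_real (\<mu> x) * schroedinger b \<mu> V u x = lap u x + complex_of_real (\<mu> x * V x) * u x"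
  using pos[of x] by (simp add: schroedinger_def lap_def field_simps)

lemma lap_cnj: "lap (\<lambda>x. cnj (u x)) x = cnj (lap u x)"
  unfolding lap_def by (simp flip: infsum_cnj)

text \<open>Green's formula. The two hypotheses make the double series absolutely convergent, so that it may
be averaged with the series in which \<open>x\<close> and \<open>y\<close> change places; this symmetrizes the test function.\<close>
lemma
  fixes u v :: "'a \<Rightarrow> complex"
  assumes diag: "(\<lambda>(x, y). b x y * cmod (u x) * cmod (v x)) summable_on UNIV"
    and offdiag: "(\<lambda>(x, y). b x y * cmod (u y) * cmod (v x)) summable_on UNIV"
  shows green_has_sum: "((\<lambda>(x, y). complex_of_real (b x y) * ((u x - u y) * (v x - v y)))
      has_sum (2 * (\<Sum>\<^sub>\<infinity>x. lap u x * v x))) UNIV"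
    and green_summable: "(\<lambda>x. lap u x * v x) summable_on UNIV"
proof -
  define P where "P x y = complex_of_real (b x y) * (u x - u y) * v x" for x y
  have "(\<lambda>p. cmod ((\<lambda>(x, y). P x y) p)) summable_on UNIV"
  proof (rule Infinite_Sum.abs_summable_on_comparison_test'[OF summable_on_add[OF diag offdiag]])
    fix p :: "'a \<times> 'a"
    obtain x y where p: "p = (x, y)" by fastforce
    have "cmod (P x y) \<le> b x y * (cmod (u x) + cmod (u y)) * cmod (v x)"
      unfolding P_def by (simp add: norm_mult mult_left_mono mult_right_mono norm_triangle_ineq4)
    then show "norm ((\<lambda>(x, y). P x y) p)
      \<le> (case p of (x, y) \<Rightarrow> b x y * cmod (u x) * cmod (v x)) + (case p of (x, y) \<Rightarrow> b x y * cmod (u y) * cmod (v x))"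
      by (simp add: p algebra_simps)
  qed
  then have sP: "(\<lambda>(x, y). P x y) summable_on UNIV" by (rule abs_summable_summable)
  then have sP': "(\<lambda>(x, y). P x y) summable_on Sigma UNIV (\<lambda>_. UNIV)" by simp
  have row: "infsum (P x) UNIV = lap u x * v x" for x
    unfolding P_def lap_def by (rule infsum_cmult_left')
  have "(\<Sum>\<^sub>\<infinity>x. lap u x * v x) = (\<Sum>\<^sub>\<infinity>(x, y). P x y)"
    using infsum_Sigma_banach[OF sP'] by (simp add: row)
  with has_sum_infsum[OF sP] have hP: "((\<lambda>(x, y). P x y) has_sum (\<Sum>\<^sub>\<infinity>x. lap u x * v x)) UNIV" by simp
  show "(\<lambda>x. lap u x * v x) summable_on UNIV"
    using summable_on_Sigma_banach[OF sP'] by (simp add: row)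
  have "((\<lambda>p. (case p of (x, y) \<Rightarrow> P x y) + (case p of (x, y) \<Rightarrow> P y x)) has_sum
      ((\<Sum>\<^sub>\<infinity>x. lap u x * v x) + (\<Sum>\<^sub>\<infinity>x. lap u x * v x))) UNIV"
    by (rule has_sum_add[OF hP has_sum_pairs_swap[OF hP]])
  also have "(\<lambda>p. (case p of (x, y) \<Rightarrow> P x y) + (case p of (x, y) \<Rightarrow> P y x))
      = (\<lambda>(x, y). complex_of_real (b x y) * ((u x - u y) * (v x - v y)))"
    by (auto simp: fun_eq_iff P_def b_sym[of _ "_::'a"] algebra_simps)
  finally show "((\<lambda>(x, y). complex_of_real (b x y) * ((u x - u y) * (v x - v y)))
      has_sum (2 * (\<Sum>\<^sub>\<infinity>x. lap u x * v x))) UNIV" by simp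
qed

section \<open>The operator on finitely supported functions\<close>

text \<open>The right-hand side of Green's formula does not change when \<open>f\<close> and \<open>cnj \<circ> g\<close> exchange their roles.\<close>
lemma
  assumes f: "f \<in> finsupp_funs" and g: "g \<in> formal_domain b"
  shows lap_pairing: "(\<Sum>\<^sub>\<infinity>x. lap f x * cnj (g x)) = (\<Sum>\<^sub>\<infinity>x. f x * cnj (lap g x))"
    and lap_pairing_summable: "(\<lambda>x. lap f x * cnj (g x)) summable_on UNIV"
proof -
  have fin: "finite {x. f x \<noteq> 0}" using f by (simp add: finsupp_funs_def)
  have gs: "(\<lambda>y. b x y * cmod (g y)) summable_on UNIV" for x using g by (simp add: formal_domain_def)
  have s1: "(\<lambda>(x, y). b x y * cmod (g x) * cmod (f x)) summable_on UNIV"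
    by (rule summable_on_pairs_finite_support[OF fin]) (auto intro: summable_on_cmult_left b_summable)
  have s2: "(\<lambda>(x, y). b x y * cmod (g y) * cmod (f x)) summable_on UNIV"
    by (rule summable_on_pairs_finite_support[OF fin]) (auto intro: gs)
  have s3: "(\<lambda>(x, y). b x y * cmod (f y) * cmod (g x)) summable_on UNIV"
    using summable_on_pairs_swap[OF s2] by (simp add: b_sym[of _ "_::'a"] ac_simps)
  have A: "((\<lambda>(x, y). complex_of_real (b x y) * ((f x - f y) * (cnj (g x) - cnj (g y))))
      has_sum (2 * (\<Sum>\<^sub>\<infinity>x. lap f x * cnj (g x)))) UNIV"
    by (rule green_has_sum) (use s1 s3 in \<open>simp_all add: ac_simps\<close>)
  have B: "((\<lambda>(x, y). complex_of_real (b x y) * ((f x - f y) * (cnj (g x) - cnj (g y))))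
      has_sum (2 * (\<Sum>\<^sub>\<infinity>x. lap (\<lambda>x. cnj (g x)) x * f x))) UNIV"
    unfolding mult.commute[of "f _ - f _"] by (rule green_has_sum) (use s1 s2 in simp_all)
  show "(\<Sum>\<^sub>\<infinity>x. lap f x * cnj (g x)) = (\<Sum>\<^sub>\<infinity>x. f x * cnj (lap g x))"
    using has_sum_unique[OF A B] by (simp add: lap_cnj ac_simps)
  show "(\<lambda>x. lap f x * cnj (g x)) summable_on UNIV"
    by (rule green_summable) (use s1 s3 in \<open>simp_all add: ac_simps\<close>)
qed

lemma schroedinger_pairing:
  assumes f: "f \<in> finsupp_funs" and g: "g \<in> formal_domain b"
  shows "l2_inner \<mu> (schroedinger b \<mu> V f) g = l2_inner \<mu> f (schroedinger b \<mu> V g)"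
proof -
  have fin: "finite {x. f x \<noteq> 0}" using f by (simp add: finsupp_funs_def)
  have s: "(\<lambda>x. complex_of_real (\<mu> x * V x) * f x * cnj (g x)) summable_on UNIV"
    by (rule finite_nonzero_values_imp_summable_on) (use fin in \<open>auto elim: finite_subset[rotated]\<close>)
  have s': "(\<lambda>x. f x * cnj (lap g x)) summable_on UNIV"
    by (rule finite_nonzero_values_imp_summable_on) (use fin in \<open>auto elim: finite_subset[rotated]\<close>)
  have "l2_inner \<mu> (schroedinger b \<mu> V f) g
      = (\<Sum>\<^sub>\<infinity>x. lap f x * cnj (g x) + complex_of_real (\<mu> x * V x) * f x * cnj (g x))"
    unfolding l2_inner_def mu_schroedinger by (simp add: algebra_simps)
  also have "\<dots> = (\<Sum>\<^sub>\<infinity>x. f x * cnj (lap g x)) + (\<Sum>\<^sub>\<infinity>x. complex_of_real (\<mu> x * V x) * f x * cnj (g x))"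
    by (simp only: infsum_add[OF lap_pairing_summable[OF f g] s] lap_pairing[OF f g])
  also have "\<dots> = (\<Sum>\<^sub>\<infinity>x. f x * cnj (lap g x) + complex_of_real (\<mu> x * V x) * f x * cnj (g x))"
    by (rule infsum_add[OF s' s, symmetric])
  also have "\<dots> = (\<Sum>\<^sub>\<infinity>x. f x * cnj (complex_of_real (\<mu> x) * schroedinger b \<mu> V g x))"
    unfolding mu_schroedinger by (simp add: algebra_simps)
  also have "\<dots> = l2_inner \<mu> f (schroedinger b \<mu> V g)"
    unfolding l2_inner_def by (simp add: algebra_simps)
  finally show ?thesis .
qed

lemma formal_domain_summable:
  assumes "u \<in> formal_domain b"
  shows "(\<lambda>y. complex_of_real (b x y) * (u x - u y)) summable_on UNIV"
proof (rule abs_summable_summable, rule Infinite_Sum.abs_summable_on_comparison_test')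
  show "(\<lambda>y. b x y * cmod (u x) + b x y * cmod (u y)) summable_on UNIV"
    using assms by (auto simp: formal_domain_def intro!: summable_on_add summable_on_cmult_left b_summable)
  show "norm (complex_of_real (b x y) * (u x - u y)) \<le> b x y * cmod (u x) + b x y * cmod (u y)" for y
    by (simp add: norm_mult mult_left_mono norm_triangle_ineq4 flip: distrib_left)
qed

lemma schroedinger_lincomb:
  assumes "f \<in> formal_domain b" "g \<in> formal_domain b"
  shows "schroedinger b \<mu> V (\<lambda>x. c * f x + d * g x) x
    = c * schroedinger b \<mu> V f x + d * schroedinger b \<mu> V g x"
proof -
  have "lap (\<lambda>x. c * f x + d * g x) x
     = (\<Sum>\<^sub>\<infinity>y. c * (complex_of_real (b x y) * (f x - f y)) + d * (complex_of_real (b x y) * (g x - g y)))"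
    unfolding lap_def by (simp add: algebra_simps)
  also have "\<dots> = c * lap f x + d * lap g x"
    unfolding lap_def
    by (subst infsum_add)
       (auto intro!: summable_on_cmult_right formal_domain_summable assms simp: infsum_cmult_right')
  finally show ?thesis unfolding schroedinger_def lap_def by (simp add: algebra_simps)
qed

lemma l2_sum: "finite F \<Longrightarrow> (\<And>i. i \<in> F \<Longrightarrow> f i \<in> l2 \<mu>) \<Longrightarrow> (\<lambda>x. \<Sum>i\<in>F. f i x) \<in> l2 \<mu>"
  by (induction F rule: finite_induct) (auto intro: l2_add)

lemma finsupp_l2: "f \<in> finsupp_funs \<Longrightarrow> f \<in> l2 \<mu>"
  unfolding l2_def finsupp_funs_def mem_Collect_eq
  by (rule finite_nonzero_values_imp_summable_on) (auto elim: finite_subset[rotated])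

lemma finsupp_lincomb:
  "f \<in> finsupp_funs \<Longrightarrow> g \<in> finsupp_funs \<Longrightarrow> (\<lambda>x. c * f x + d * g x) \<in> finsupp_funs"
  unfolding finsupp_funs_def mem_Collect_eq
  by (rule finite_subset[of _ "{x. f x \<noteq> 0} \<union> {x. g x \<noteq> 0}"]) auto

lemma finsupp_dense:
  assumes f: "f \<in> l2 \<mu>" and e: "0 < e"
  obtains g where "g \<in> finsupp_funs" "l2_norm \<mu> (\<lambda>x. f x - g x) < e"
proof -
  let ?s = "\<lambda>x. \<mu> x * (cmod (f x))\<^sup>2"
  have s: "?s summable_on UNIV" using f by (simp add: l2_def)
  obtain F where F: "finite F" "dist (sum ?s F) (infsum ?s UNIV) \<le> (e/2)\<^sup>2"
    using infsum_finite_approximation[OF s, of "(e/2)\<^sup>2"] e by auto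
  define g where "g x = (if x \<in> F then f x else 0)" for x
  have g: "g \<in> finsupp_funs" unfolding finsupp_funs_def g_def using F(1) by (auto elim: finite_subset[rotated])
  have "l2_norm \<mu> (\<lambda>x. f x - g x) \<le> e / 2"
  proof (rule l2I)
    fix A :: "'a set" assume A: "finite A"
    have "(\<Sum>x\<in>A. \<mu> x * (cmod (f x - g x))\<^sup>2) = sum ?s (A - F)"
      by (rule sum.mono_neutral_cong_right) (auto simp: A g_def)
    also have "\<dots> + sum ?s F = sum ?s (A \<union> F)"
      using sum.union_disjoint[of "A - F" F ?s] A F(1) by (auto simp: Diff_Int_distrib2)
    also have "sum ?s (A \<union> F) \<le> infsum ?s UNIV"
      by (rule finite_sum_le_infsum[OF s]) (use A F pos in \<open>auto simp: less_imp_le\<close>)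
    finally have "(\<Sum>x\<in>A. \<mu> x * (cmod (f x - g x))\<^sup>2) \<le> (e/2)\<^sup>2"
      using F(2) by (simp add: dist_real_def)
    then show "l2_partial (\<lambda>x. f x - g x) A \<le> e / 2"
      unfolding l2_partial_eq using e by (intro real_le_lsqrt) auto
  qed
  with e have "l2_norm \<mu> (\<lambda>x. f x - g x) < e" by simp
  with g that show ?thesis by blast
qed

lemma l2_inner_indicator:
  "l2_inner \<mu> (\<lambda>y. if y = x then 1 else 0) h = complex_of_real (\<mu> x) * cnj (h x)"
proof -
  have "l2_inner \<mu> (\<lambda>y. if y = x then 1 else 0) h
      = (\<Sum>\<^sub>\<infinity>y\<in>{x}. complex_of_real (\<mu> y) * cnj (h y))"
    unfolding l2_inner_def by (rule infsum_cong_neutral) auto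
  then show ?thesis by simp
qed

context
  assumes FC: "finiteness_condition b \<mu>"
begin

text \<open>By the finiteness condition the series \<open>\<Sum>y. b x y * cmod (g y)\<close> is, up to absolute values, an inner product
of two square summable functions.\<close>
lemma l2_subset_formal_domain: "l2 \<mu> \<subseteq> formal_domain b"
proof
  fix g assume g: "g \<in> l2 \<mu>"
  have "(\<lambda>y. b x y * cmod (g y)) summable_on UNIV" for x
  proof -
    have "(\<lambda>y. complex_of_real (b x y / \<mu> y)) \<in> l2 \<mu>" using FC by (simp add: finiteness_condition_def)
    from l2_inner_abs_summable(1)[OF this g] show ?thesis
      by (rule summable_on_cong[THEN iffD1, rotated]) (use pos in \<open>simp add: norm_mult norm_divide less_imp_le less_imp_neq[OF pos, symmetric]\<close>)
  qed
  then show "g \<in> formal_domain b" by (simp add: formal_domain_def)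
qed

text \<open>Off the finite support of \<open>f\<close> the image is a linear combination of the functions \<open>x \<mapsto> b y x / \<mu> x\<close>
with \<open>y\<close> in the support, and these are square summable by the finiteness condition.\<close>
lemma schroedinger_finsupp_l2:
  assumes f: "f \<in> finsupp_funs"
  shows "schroedinger b \<mu> V f \<in> l2 \<mu>"
proof -
  define F where "F = {x. f x \<noteq> 0}"
  have F: "finite F" using f by (simp add: finsupp_funs_def F_def)
  define p where "p x = (complex_of_real (deg x / \<mu> x) + complex_of_real (V x)) * f x" for x
  have "p \<in> finsupp_funs"
    unfolding finsupp_funs_def mem_Collect_eq
    by (rule finite_subset[OF _ F]) (auto simp: p_def F_def)
  then have p: "p \<in> l2 \<mu>" by (rule finsupp_l2)
  have q: "(\<lambda>x. \<Sum>y\<in>F. f y * complex_of_real (b y x / \<mu> x)) \<in> l2 \<mu>"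
    using FC by (intro l2_sum F l2_scale) (simp add: finiteness_condition_def)
  have "schroedinger b \<mu> V f x = p x - (\<Sum>y\<in>F. f y * complex_of_real (b y x / \<mu> x))" for x
  proof -
    have 1: "((\<lambda>y. complex_of_real (b x y) * f x) has_sum (complex_of_real (deg x) * f x)) UNIV"
      unfolding deg_def by (intro has_sum_cmult_left has_sum_of_real has_sum_infsum b_summable)
    have 2: "((\<lambda>y. - (complex_of_real (b x y) * f y)) has_sum (\<Sum>y\<in>F. - (complex_of_real (b x y) * f y))) UNIV"
      by (rule has_sum_finite_neutralI[OF F]) (auto simp: F_def)
    from infsumI[OF has_sum_add[OF 1 2]]
    have L: "lap f x = complex_of_real (deg x) * f x - (\<Sum>y\<in>F. complex_of_real (b x y) * f y)"
      unfolding lap_def by (simp add: algebra_simps sum_negf)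
    show ?thesis unfolding schroedinger_def p_def lap_def[symmetric]
      by (simp add: L algebra_simps sum_divide_distrib diff_divide_distrib b_sym[of x])
  qed
  then have "schroedinger b \<mu> V f = (\<lambda>x. p x - (\<Sum>y\<in>F. f y * complex_of_real (b y x / \<mu> x)))" by blast
  with l2_diff[OF p q] show ?thesis by simp
qed

lemma schroedinger_symmetric:
  "symmetric_operator \<mu> (restrict_op (schroedinger b \<mu> V) finsupp_funs)" (is "symmetric_operator \<mu> ?T")
  unfolding symmetric_operator_def l2_operator_def
proof (intro conjI allI impI)
  note fd = subsetD[OF finsupp_funs_subset_formal_domain]
  show "?T \<subseteq> l2 \<mu> \<times> l2 \<mu>"
    by (auto simp: restrict_op_def intro: finsupp_l2 schroedinger_finsupp_l2)
  show "single_valued ?T" by (auto simp: restrict_op_def single_valued_def)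
  have "schroedinger b \<mu> V (\<lambda>x. 0) = (\<lambda>x. 0)" by (simp add: schroedinger_def fun_eq_iff)
  then show "((\<lambda>x. 0), (\<lambda>x. 0)) \<in> ?T" by (auto simp: restrict_op_def finsupp_funs_def)
  show "((\<lambda>x. c * f x + d * g x), (\<lambda>x. c * f' x + d * g' x)) \<in> ?T"
    if "(f, f') \<in> ?T" "(g, g') \<in> ?T" for f f' g g' c d
    using that by (auto simp: restrict_op_def fun_eq_iff schroedinger_lincomb[OF fd fd] intro!: finsupp_lincomb)
  show "densely_defined \<mu> ?T"
    unfolding densely_defined_def
  proof (intro ballI allI impI)
    fix f and e :: real assume "f \<in> l2 \<mu>" "0 < e"
    then obtain g where "g \<in> finsupp_funs" "l2_norm \<mu> (\<lambda>x. f x - g x) < e" by (rule finsupp_dense)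
    then show "\<exists>g\<in>Domain ?T. l2_norm \<mu> (\<lambda>x. f x - g x) < e"
      by (intro bexI[of _ g]) (auto simp: restrict_op_def)
  qed
  show "\<forall>(f, f')\<in>?T. \<forall>(g, g')\<in>?T. l2_inner \<mu> f' g = l2_inner \<mu> f g'"
    by (auto simp: restrict_op_def intro!: schroedinger_pairing fd)
qed

text \<open>The adjoint acts by the formal operator: testing against the indicator of a point evaluates
both sides at that point.\<close>
lemma adjoint_schroedinger:
  assumes "(g, h) \<in> adjoint_op \<mu> (restrict_op (schroedinger b \<mu> V) finsupp_funs)"
  shows "h = schroedinger b \<mu> V g"
proof
  fix x :: 'a
  let ?d = "\<lambda>y. if y = x then 1 else 0 :: complex"
  have d: "?d \<in> finsupp_funs" by (simp add: finsupp_funs_def)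
  have "g \<in> formal_domain b" using adjoint_opD(1)[OF assms] l2_subset_formal_domain by blast
  then have "l2_inner \<mu> ?d (schroedinger b \<mu> V g) = l2_inner \<mu> ?d h"
    using adjoint_opD(3)[OF assms, of ?d "schroedinger b \<mu> V ?d"] d
    by (auto simp: restrict_op_def schroedinger_pairing)
  then show "h x = schroedinger b \<mu> V g x"
    unfolding l2_inner_indicator using pos[of x] by simp
qed

end

end

section \<open>Logarithmic cut-off functions\<close>

text \<open>The logarithm makes the cut-off equal to \<open>0\<close> beyond \<open>exp n\<close> while its slope at \<open>t\<close> is only
\<open>1 / (n * t)\<close>. The decay \<open>1 / t\<close> of the slope compensates for the weight \<open>1 / Q\<close> in the energy
estimate, and the factor \<open>1 / n\<close> makes the commutator with the cut-off disappear in the limit.\<close>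
definition log_cut :: "real \<Rightarrow> real \<Rightarrow> real" where
  "log_cut n t = max 0 (1 - ln t / n)"

lemma log_cut_nonneg: "0 \<le> log_cut n t" by (simp add: log_cut_def)

lemma log_cut_le_1: "0 < n \<Longrightarrow> 1 \<le> t \<Longrightarrow> log_cut n t \<le> 1" by (simp add: log_cut_def)

lemma log_cut_support:
  assumes "0 < n" "1 \<le> t" "log_cut n t \<noteq> 0" shows "t \<le> exp n"
proof -
  have "ln t < n" using assms by (auto simp: log_cut_def max_def field_simps split: if_splits)
  then show ?thesis using assms(2) by (simp add: ln_le_cancel_iff[symmetric] del: ln_le_cancel_iff)
qed

lemma ln_diff_le: "0 < s \<Longrightarrow> s \<le> t \<Longrightarrow> ln t - ln s \<le> (t - s) / (s::real)"
  using ln_le_minus_one[of "t / s"] by (simp add: ln_div diff_divide_distrib)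

lemma log_cut_diff_le:
  assumes "0 < n" "0 < s" "s \<le> t"
  shows "\<bar>log_cut n s - log_cut n t\<bar> \<le> (t - s) / (n * s)"
proof -
  have "\<bar>max 0 (1 - A) - max 0 (1 - B)\<bar> \<le> B - A" if "A \<le> B" for A B :: real
    using that by (simp add: max_def)
  moreover have "ln s / n \<le> ln t / n" using assms by (intro divide_right_mono) simp_all
  ultimately have "\<bar>log_cut n s - log_cut n t\<bar> \<le> (ln t - ln s) / n"
    unfolding log_cut_def diff_divide_distrib by blast
  also have "\<dots> \<le> ((t - s) / s) / n"
    using ln_diff_le[of s t] assms by (intro divide_right_mono) auto
  finally show ?thesis by (simp add: mult.commute)
qed

lemma log_cut_over_id_lipschitz:
  assumes n: "1 \<le> n" and st: "1 \<le> s" "1 \<le> t"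
  shows "\<bar>log_cut n s / s - log_cut n t / t\<bar> \<le> 2 * \<bar>s - t\<bar>"
  using st
proof (induction s t rule: linorder_wlog)
  case (le s t)
  have "s * 1 \<le> s * t" using le by (intro mult_left_mono) auto
  have "\<bar>log_cut n s - log_cut n t\<bar> \<le> (t - s) / (n * s)" using log_cut_diff_le[of n s t] n le by simp
  also have "\<dots> \<le> (t - s) / 1" 
    using mult_mono[of 1 n 1 s] n le by (intro divide_left_mono) auto
  finally have 1: "\<bar>log_cut n s - log_cut n t\<bar> \<le> t - s" by simp
  have 2: "\<bar>1 / s - 1 / t\<bar> \<le> t - s"
  proof -
    have "1 / s - 1 / t = (t - s) / (s * t)" using le by (simp add: field_simps)
    also have "\<dots> \<le> (t - s) / 1"
      using mult_mono[of 1 s 1 t] le by (intro divide_left_mono) auto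
    finally show ?thesis using le by (simp add: frac_le)
  qed
  have "log_cut n s / s - log_cut n t / t = (log_cut n s - log_cut n t) * (1 / s) + log_cut n t * (1 / s - 1 / t)"
    by (simp add: algebra_simps)
  then have "\<bar>log_cut n s / s - log_cut n t / t\<bar> \<le> \<bar>log_cut n s - log_cut n t\<bar> * (1 / s) + log_cut n t * \<bar>1 / s - 1 / t\<bar>"
    using le log_cut_nonneg[of n t] abs_triangle_ineq[of "(log_cut n s - log_cut n t) * (1 / s)" "log_cut n t * (1 / s - 1 / t)"]
    by (simp add: abs_mult)
  also have "\<dots> \<le> (t - s) * 1 + 1 * (t - s)"
    using le log_cut_le_1[of n t] n by (intro add_mono mult_mono 1 2) (auto simp: log_cut_nonneg)
  finally show ?case using le by simp
next
  case (sym s t)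
  then show ?case by (simp add: abs_minus_commute)
qed

text \<open>If the cut-off does not vanish at the smaller point \<open>s\<close>, then the cut-off with twice the
parameter is at least \<open>1 / 2\<close> there. Hence the slope \<open>1 / (n * s)\<close> is dominated by the weight
that occurs in the energy estimate for the parameter \<open>2 * n\<close>.\<close>
lemma log_cut_lipschitz_weighted:
  assumes n: "1 \<le> n" and st: "1 \<le> s" "1 \<le> t"
  shows "\<bar>log_cut n s - log_cut n t\<bar>
    \<le> 2 / n * \<bar>s - t\<bar> * sqrt ((log_cut (2 * n) s / s)\<^sup>2 + (log_cut (2 * n) t / t)\<^sup>2)"
  using st
proof (induction s t rule: linorder_wlog)
  case (le s t)
  show ?case
  proof (cases "ln s \<ge> n")
    case True
    moreover have "ln t \<ge> n" using True le ln_le_cancel_iff[of s t] by linarith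
    ultimately have "log_cut n s = 0" "log_cut n t = 0" using n by (auto simp: log_cut_def)
    then show ?thesis using n by simp
  next
    case False
    have "1 / 2 \<le> log_cut (2 * n) s" using False n by (simp add: log_cut_def field_simps)
    then have "1 / (2 * s) \<le> log_cut (2 * n) s / s" using le by (simp add: field_simps)
    also have "\<dots> \<le> sqrt ((log_cut (2 * n) s / s)\<^sup>2 + (log_cut (2 * n) t / t)\<^sup>2)"
      by (rule real_le_rsqrt) simp
    finally have half: "1 / (2 * s) \<le> sqrt ((log_cut (2 * n) s / s)\<^sup>2 + (log_cut (2 * n) t / t)\<^sup>2)" .
    have "\<bar>log_cut n s - log_cut n t\<bar> \<le> 2 / n * (t - s) * (1 / (2 * s))"
      using log_cut_diff_le[of n s t] n le by (simp add: field_simps)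
    also have "\<dots> \<le> 2 / n * (t - s) * sqrt ((log_cut (2 * n) s / s)\<^sup>2 + (log_cut (2 * n) t / t)\<^sup>2)"
      using n le by (intro mult_left_mono half) auto
    finally show ?thesis using le by simp
  qed
next
  case (sym s t)
  then show ?case by (simp add: abs_minus_commute add.commute)
qed

lemma log_cut_tendsto_1: "(\<lambda>n. log_cut (real (Suc n)) t) \<longlonglongrightarrow> 1"
proof -
  have "(\<lambda>n. max 0 (1 - ln t * (1 / real (Suc n)))) \<longlonglongrightarrow> max 0 (1 - ln t * 0)"
    by (intro tendsto_intros LIMSEQ_Suc[OF lim_1_over_n])
  then show ?thesis by (simp add: log_cut_def)
qed

section \<open>Energy estimates and absence of deficiency\<close>

text \<open>The discrete Leibniz rule for \<open>s\<close> times \<open>cnj p\<close>. The first term is real and is the localized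
energy; the second one contains the gradient of the cut-off. The real part of the identity therefore
controls the energy, and its imaginary part sees the commutator only.\<close>
lemma energy_density_split:
  fixes p q :: complex and s t :: real
  shows "(p - q) * (of_real s * cnj p - of_real t * cnj q)
    = of_real ((s + t) / 2 * (cmod (p - q))\<^sup>2) + of_real ((s - t) / 2) * ((p - q) * cnj (p + q))"
  unfolding of_real_mult[of _ "(cmod (p - q))\<^sup>2"] complex_norm_square by (simp add: field_simps)

text \<open>The cross term of the Leibniz rule is at most \<open>|s^2 - t^2| / 2\<close> times the norms of \<open>p - q\<close> and \<open>p + q\<close>. Writing
\<open>s^2 - t^2 = (s + t) * (s - t)\<close> and using Young's inequality, half of the localized energy absorbs the part
with \<open>s + t\<close>.\<close>
lemma energy_density_Re_ge:
  fixes p q :: complex and s t :: real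
  shows "(s\<^sup>2 + t\<^sup>2) * (cmod (p - q))\<^sup>2 \<le> 4 * Re ((p - q) * (of_real (s\<^sup>2) * cnj p - of_real (t\<^sup>2) * cnj q))
    + 4 * (s - t)\<^sup>2 * ((cmod p)\<^sup>2 + (cmod q)\<^sup>2)"
proof -
  define d where "d = cmod (p - q)"
  define a where "a = cmod (p + q)"
  have a: "a\<^sup>2 \<le> 2 * ((cmod p)\<^sup>2 + (cmod q)\<^sup>2)"
  proof -
    have "a\<^sup>2 \<le> (cmod p + cmod q)\<^sup>2" unfolding a_def by (intro power_mono norm_triangle_ineq) auto
    also have "\<dots> \<le> 2 * ((cmod p)\<^sup>2 + (cmod q)\<^sup>2)" using sum_squares_bound[of "cmod p" "cmod q"] by (simp add: power2_sum)
    finally show ?thesis .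
  qed
  have "\<bar>Re ((p - q) * cnj (p + q))\<bar> \<le> d * a"
    unfolding d_def a_def using abs_Re_le_cmod[of "(p - q) * cnj (p + q)"] by (simp add: norm_mult del: complex_cnj_add)
  then have "\<bar>(s\<^sup>2 - t\<^sup>2) / 2 * Re ((p - q) * cnj (p + q))\<bar> \<le> \<bar>(s\<^sup>2 - t\<^sup>2) / 2\<bar> * (d * a)"
    unfolding abs_mult by (rule mult_left_mono) simp
  also have "\<bar>(s\<^sup>2 - t\<^sup>2) / 2\<bar> * (d * a) = \<bar>(s + t) * d\<bar> * \<bar>(s - t) * a\<bar> / 2"
    by (simp add: abs_mult d_def a_def power2_eq_square square_diff_square_factored)
  also have "\<dots> \<le> ((s + t) * d)\<^sup>2 / 8 + ((s - t) * a)\<^sup>2 / 2"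
    using sum_squares_bound[of "\<bar>(s + t) * d\<bar> / 2" "\<bar>(s - t) * a\<bar>"] by (simp add: power_divide field_simps)
  also have "((s + t) * d)\<^sup>2 / 8 \<le> (s\<^sup>2 + t\<^sup>2) * d\<^sup>2 / 4"
  proof -
    have "(s + t)\<^sup>2 \<le> 2 * (s\<^sup>2 + t\<^sup>2)" using sum_squares_bound[of s t] by (simp add: power2_sum)
    from mult_right_mono[OF this, of "d\<^sup>2"] show ?thesis unfolding power_mult_distrib by (simp add: algebra_simps)
  qed
  also have "((s - t) * a)\<^sup>2 / 2 \<le> (s - t)\<^sup>2 * ((cmod p)\<^sup>2 + (cmod q)\<^sup>2)"
    using mult_left_mono[OF a, of "(s - t)\<^sup>2"] by (simp add: power_mult_distrib distrib_left)
  finally have "\<bar>(s\<^sup>2 - t\<^sup>2) / 2 * Re ((p - q) * cnj (p + q))\<bar>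
     \<le> (s\<^sup>2 + t\<^sup>2) * d\<^sup>2 / 4 + (s - t)\<^sup>2 * ((cmod p)\<^sup>2 + (cmod q)\<^sup>2)" by simp
  moreover have "Re (of_real A + of_real B * z) = A + B * Re z" for A B :: real and z by simp
  then have "Re ((p - q) * (of_real (s\<^sup>2) * cnj p - of_real (t\<^sup>2) * cnj q))
     = (s\<^sup>2 + t\<^sup>2) / 2 * d\<^sup>2 + (s\<^sup>2 - t\<^sup>2) / 2 * Re ((p - q) * cnj (p + q))"
    unfolding energy_density_split d_def by blast
  ultimately show ?thesis unfolding d_def[symmetric] by linarith
qed

lemma energy_density_Im_le:
  fixes p q :: complex and s t :: real
  shows "\<bar>Im ((p - q) * (of_real s * cnj p - of_real t * cnj q))\<bar> \<le> \<bar>s - t\<bar> / 2 * (cmod (p - q) * cmod (p + q))"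
proof -
  have "\<bar>Im ((p - q) * (of_real s * cnj p - of_real t * cnj q))\<bar> = \<bar>s - t\<bar> / 2 * \<bar>Im ((p - q) * cnj (p + q))\<bar>"
    unfolding energy_density_split by (simp add: abs_mult del: complex_cnj_add)
  moreover have "\<bar>Im ((p - q) * cnj (p + q))\<bar> \<le> cmod (p - q) * cmod (p + q)"
    using abs_Im_le_cmod[of "(p - q) * cnj (p + q)"] by (simp add: norm_mult del: complex_cnj_add)
  then have "\<bar>s - t\<bar> / 2 * \<bar>Im ((p - q) * cnj (p + q))\<bar> \<le> \<bar>s - t\<bar> / 2 * (cmod (p - q) * cmod (p + q))"
    by (rule mult_left_mono) simp
  ultimately show ?thesis by simp
qed

text \<open>All geometric information is condensed in one function \<open>Q\<close>: it is Lipschitz on average with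
respect to \<open>b\<close>, and the degree is bounded on its sublevel sets.\<close>
locale exhausted_graph = graph_space +
  fixes Q :: "'a \<Rightarrow> real" and K :: real
  assumes Q_ge_1: "1 \<le> Q x"
    and Q_summable: "(\<lambda>y. b x y * (Q x - Q y)\<^sup>2) summable_on UNIV"
    and Q_energy: "(\<Sum>\<^sub>\<infinity>y. b x y * (Q x - Q y)\<^sup>2) \<le> K * \<mu> x"
    and Q_deg: "\<exists>D. \<forall>x. Q x \<le> r \<longrightarrow> deg x \<le> D * \<mu> x"
begin

text \<open>The total edge weight from a vertex \<open>x\<close> into a sublevel set is controlled by \<open>\<mu> x\<close> even where the
degree at \<open>x\<close> is unbounded: edges from far outside have length at least \<open>1\<close> in the sense of \<open>Q\<close>, so
that the energy of \<open>Q\<close> dominates their weight.\<close>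
lemma sublevel_mass:
  "\<exists>C. \<forall>x. (\<Sum>\<^sub>\<infinity>y. b x y * of_bool (Q y \<le> r)) \<le> C * \<mu> x"
proof -
  obtain D where D: "\<And>x. Q x \<le> r + 1 \<Longrightarrow> deg x \<le> D * \<mu> x" using Q_deg by blast
  have s: "(\<lambda>y. b x y * of_bool (Q y \<le> r)) summable_on UNIV" for x
    by (rule summable_on_comparison_test[OF b_summable[of x]]) auto
  have "(\<Sum>\<^sub>\<infinity>y. b x y * of_bool (Q y \<le> r)) \<le> max D K * \<mu> x" for x
  proof (cases "Q x \<le> r + 1")
    case True
    have "(\<Sum>\<^sub>\<infinity>y. b x y * of_bool (Q y \<le> r)) \<le> deg x"
      unfolding deg_def by (rule infsum_mono[OF s b_summable]) auto
    also have "\<dots> \<le> D * \<mu> x" by (rule D[OF True])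
    also have "\<dots> \<le> max D K * \<mu> x" using pos[of x] by (intro mult_right_mono) auto
    finally show ?thesis .
  next
    case False
    have "(\<Sum>\<^sub>\<infinity>y. b x y * of_bool (Q y \<le> r)) \<le> (\<Sum>\<^sub>\<infinity>y. b x y * (Q x - Q y)\<^sup>2)"
    proof (rule infsum_mono[OF s Q_summable])
      fix y
      have "of_bool (Q y \<le> r) \<le> (Q x - Q y)\<^sup>2"
        using False power_mono[of 1 "Q x - Q y" 2] by auto
      then show "b x y * of_bool (Q y \<le> r) \<le> b x y * (Q x - Q y)\<^sup>2" by (rule mult_left_mono) simp
    qed
    also have "\<dots> \<le> K * \<mu> x" by (rule Q_energy)
    also have "\<dots> \<le> max D K * \<mu> x" using pos[of x] by (intro mult_right_mono) auto
    finally show ?thesis .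
  qed
  then show ?thesis by blast
qed

context
  fixes u :: "'a \<Rightarrow> complex"
  assumes u: "u \<in> l2 \<mu>"
begin

abbreviation mass :: real where "mass \<equiv> (\<Sum>\<^sub>\<infinity>x. \<mu> x * (cmod (u x))\<^sup>2)"

lemma u_summable: "(\<lambda>x. \<mu> x * (cmod (u x))\<^sup>2) summable_on UNIV"
  using u by (simp add: l2_def)

lemma energy_u_has_sum: "\<exists>s\<le>2 * K * mass.
    ((\<lambda>(x, y). b x y * (Q x - Q y)\<^sup>2 * ((cmod (u x))\<^sup>2 + (cmod (u y))\<^sup>2)) has_sum s) UNIV"
proof -
  define H where "H x y = b x y * (Q x - Q y)\<^sup>2 * (cmod (u x))\<^sup>2" for x y
  have le: "infsum (H x) UNIV \<le> K * (\<mu> x * (cmod (u x))\<^sup>2)" for x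
    using mult_right_mono[OF Q_energy[of x], of "(cmod (u x))\<^sup>2"]
    unfolding H_def infsum_cmult_left' by (simp add: mult.assoc)
  have row: "H x summable_on UNIV" for x
    unfolding H_def by (intro summable_on_cmult_left Q_summable)
  have col: "(\<lambda>x. K * (\<mu> x * (cmod (u x))\<^sup>2)) summable_on UNIV"
    by (intro summable_on_cmult_right u_summable)
  have H0: "0 \<le> H x y" for x y by (simp add: H_def)
  have sH: "(\<lambda>(x, y). H x y) summable_on UNIV" "(\<Sum>\<^sub>\<infinity>(x, y). H x y) \<le> (\<Sum>\<^sub>\<infinity>x. K * (\<mu> x * (cmod (u x))\<^sup>2))"
    by (rule summable_on_pairsI[OF H0 row le col], rule infsum_pairs_le[OF H0 row le col])
  have "((\<lambda>p. (case p of (x, y) \<Rightarrow> H x y) + (case p of (x, y) \<Rightarrow> H y x)) has_sum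
      ((\<Sum>\<^sub>\<infinity>(x, y). H x y) + (\<Sum>\<^sub>\<infinity>(x, y). H x y))) UNIV"
    by (rule has_sum_add[OF has_sum_infsum[OF sH(1)] has_sum_pairs_swap[OF has_sum_infsum[OF sH(1)]]])
  also have "(\<lambda>p. (case p of (x, y) \<Rightarrow> H x y) + (case p of (x, y) \<Rightarrow> H y x))
      = (\<lambda>(x, y). b x y * (Q x - Q y)\<^sup>2 * ((cmod (u x))\<^sup>2 + (cmod (u y))\<^sup>2))"
    by (auto simp: fun_eq_iff H_def b_sym[of _ "_::'a"] power2_commute algebra_simps)
  finally show ?thesis using sH(2) by (intro exI[of _ "(\<Sum>\<^sub>\<infinity>(x, y). H x y) + (\<Sum>\<^sub>\<infinity>(x, y). H x y)"])
      (simp add: infsum_cmult_right')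
qed

text \<open>Green's formula for \<open>u\<close> against \<open>th * cnj u\<close>. The diagonal terms converge because the degree is bounded
on the support of \<open>th\<close>, the other ones by the bound \<open>sublevel_mass\<close>.\<close>
lemma
  assumes th: "\<And>x. 0 \<le> th x" "\<And>x. th x \<le> 1" "\<And>x. th x \<noteq> 0 \<Longrightarrow> Q x \<le> r"
  shows localized_green_has_sum: "((\<lambda>(x, y). complex_of_real (b x y) *
        ((u x - u y) * (of_real (th x) * cnj (u x) - of_real (th y) * cnj (u y))))
      has_sum (2 * (\<Sum>\<^sub>\<infinity>x. lap u x * (of_real (th x) * cnj (u x))))) UNIV"
    and localized_green_summable: "(\<lambda>x. lap u x * (of_real (th x) * cnj (u x))) summable_on UNIV"
proof -
  obtain D where D: "\<And>x. Q x \<le> r \<Longrightarrow> deg x \<le> D * \<mu> x" using Q_deg by blast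
  obtain C where C: "\<And>x. (\<Sum>\<^sub>\<infinity>y. b x y * of_bool (Q y \<le> r)) \<le> C * \<mu> x" using sublevel_mass by blast
  define D' where "D' = max D 0"
  have diag': "(\<lambda>(x, y). b x y * (th x * (cmod (u x))\<^sup>2)) summable_on UNIV"
  proof (rule summable_on_pairsI)
    show "(\<lambda>x. D' * (\<mu> x * (cmod (u x))\<^sup>2)) summable_on UNIV"
      by (intro summable_on_cmult_right u_summable)
    fix x
    have "deg x * (th x * (cmod (u x))\<^sup>2) \<le> D' * (\<mu> x * (cmod (u x))\<^sup>2)"
    proof (cases "th x = 0")
      case True
      then show ?thesis using pos[of x] by (simp add: D'_def less_imp_le)
    next
      case False
      have "deg x \<le> D' * \<mu> x"
        using D[OF th(3)[OF False]] mult_right_mono[of D D' "\<mu> x"] pos[of x]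
        unfolding D'_def by (meson less_imp_le max.cobounded1 order_trans)
      then have "deg x * (th x * (cmod (u x))\<^sup>2) \<le> (D' * \<mu> x) * (1 * (cmod (u x))\<^sup>2)"
        using th(1,2)[of x] pos[of x] by (intro mult_mono) (auto simp: D'_def less_imp_le)
      then show ?thesis by (simp add: mult.assoc)
    qed
    then show "(\<Sum>\<^sub>\<infinity>y. b x y * (th x * (cmod (u x))\<^sup>2)) \<le> D' * (\<mu> x * (cmod (u x))\<^sup>2)"
      by (simp add: infsum_cmult_left' deg_def)
  qed (auto simp: th intro!: summable_on_cmult_left b_summable)
  have off': "(\<lambda>(x, y). b x y * (th y * (cmod (u x))\<^sup>2)) summable_on UNIV"
  proof (rule summable_on_pairsI)
    show "(\<lambda>x. C * (\<mu> x * (cmod (u x))\<^sup>2)) summable_on UNIV"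
      by (intro summable_on_cmult_right u_summable)
    fix x
    have le: "b x y * th y \<le> b x y * of_bool (Q y \<le> r)" for y
      using th(2,3)[of y] by (cases "th y = 0") (auto intro: mult_left_le)
    have s1: "(\<lambda>y. b x y * of_bool (Q y \<le> r)) summable_on UNIV"
      by (rule summable_on_comparison_test[OF b_summable[of x]]) auto
    have s2: "(\<lambda>y. b x y * th y) summable_on UNIV"
      by (rule summable_on_comparison_test[OF s1 le]) (simp add: th)
    show "(\<lambda>y. b x y * (th y * (cmod (u x))\<^sup>2)) summable_on UNIV"
      using summable_on_cmult_left[OF s2, of "(cmod (u x))\<^sup>2"] by (simp add: mult.assoc)
    have "(\<Sum>\<^sub>\<infinity>y. b x y * th y) \<le> C * \<mu> x"
      using infsum_mono[OF s2 s1 le] C[of x] by linarith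
    then show "(\<Sum>\<^sub>\<infinity>y. b x y * (th y * (cmod (u x))\<^sup>2)) \<le> C * (\<mu> x * (cmod (u x))\<^sup>2)"
      using mult_right_mono[of "\<Sum>\<^sub>\<infinity>y. b x y * th y" "C * \<mu> x" "(cmod (u x))\<^sup>2"]
      by (simp add: infsum_cmult_left' mult.assoc[symmetric])
  qed (auto simp: th)
  have diag: "(\<lambda>(x, y). b x y * cmod (u x) * cmod (of_real (th x) * cnj (u x))) summable_on UNIV"
    using diag' by (simp add: norm_mult th power2_eq_square ac_simps)
  have offdiag: "(\<lambda>(x, y). b x y * cmod (u y) * cmod (of_real (th x) * cnj (u x))) summable_on UNIV"
  proof (rule summable_on_comparison_test[OF summable_on_add[OF diag' summable_on_pairs_swap[OF off']]])
    fix p :: "'a \<times> 'a"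
    obtain x y where p: "p = (x, y)" by fastforce
    have "cmod (u y) * cmod (u x) \<le> (cmod (u x))\<^sup>2 + (cmod (u y))\<^sup>2"
      using sum_squares_bound[of "cmod (u x)" "cmod (u y)"] by (simp add: ac_simps)
        (smt (verit) mult_nonneg_nonneg norm_ge_zero)
    from mult_left_mono[OF this, of "b x y * th x"] th(1)
    show "(case p of (x, y) \<Rightarrow> b x y * cmod (u y) * cmod (of_real (th x) * cnj (u x)))
      \<le> (case p of (x, y) \<Rightarrow> b x y * (th x * (cmod (u x))\<^sup>2)) + (case p of (x, y) \<Rightarrow> b y x * (th x * (cmod (u y))\<^sup>2))"
      by (simp add: p norm_mult b_sym[of y x] algebra_simps)
  qed auto
  show "((\<lambda>(x, y). complex_of_real (b x y) *
        ((u x - u y) * (of_real (th x) * cnj (u x) - of_real (th y) * cnj (u y))))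
      has_sum (2 * (\<Sum>\<^sub>\<infinity>x. lap u x * (of_real (th x) * cnj (u x))))) UNIV"
    by (rule green_has_sum[OF diag offdiag])
  show "(\<lambda>x. lap u x * (of_real (th x) * cnj (u x))) summable_on UNIV"
    by (rule green_summable[OF diag offdiag])
qed

context
  fixes V :: "'a \<Rightarrow> real" and \<kappa> :: complex
  assumes V_ge: "\<And>x. - V x \<le> (Q x)\<^sup>2"
    and eigen: "schroedinger b \<mu> V u = (\<lambda>x. \<kappa> * u x)"
    and imag: "Re \<kappa> = 0" "\<bar>Im \<kappa>\<bar> = 1"
begin

lemma lap_eigen: "lap u x * (of_real t * cnj (u x)) = (\<kappa> - of_real (V x)) * of_real (t * (\<mu> x * (cmod (u x))\<^sup>2))"
proof -
  have "lap u x = of_real (\<mu> x) * (\<kappa> - of_real (V x)) * u x"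
    using mu_schroedinger[of x V u] unfolding eigen by (simp add: algebra_simps)
  then have "lap u x * (of_real t * cnj (u x)) = (\<kappa> - of_real (V x)) * of_real (t * \<mu> x) * (u x * cnj (u x))"
    by simp
  also have "\<dots> = (\<kappa> - of_real (V x)) * of_real (t * \<mu> x) * of_real ((cmod (u x))\<^sup>2)"
    by (simp only: complex_norm_square)
  finally show ?thesis by (simp add: ac_simps)
qed

text \<open>A Caccioppoli estimate: the energy of \<open>u\<close> with weight \<open>1 / Q^2\<close> is bounded by the mass of \<open>u\<close>,
uniformly in the cut-off. The test function is \<open>(log_cut n Q / Q)\<^sup>2 * cnj u\<close>. In the real part of Green's formula
the imaginary eigenvalue drops out, the negative part of \<open>V\<close> is absorbed by the weight, and the gradient
of \<open>log_cut n Q / Q\<close> is bounded by that of \<open>Q\<close>.\<close>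
lemma weighted_energy:
  assumes n: "1 \<le> n"
  shows "\<exists>s\<le>(8 + 32 * K) * mass. ((\<lambda>(x, y). b x y *
    (((log_cut n (Q x) / Q x)\<^sup>2 + (log_cut n (Q y) / Q y)\<^sup>2) * (cmod (u x - u y))\<^sup>2)) has_sum s) UNIV"
proof -
  define psi where "psi x = log_cut n (Q x) / Q x" for x
  have Q: "0 < Q x" for x using Q_ge_1[of x] by linarith
  have psi0: "0 \<le> psi x" for x using Q[of x] by (simp add: psi_def log_cut_nonneg)
  have psiQ: "psi x * Q x \<le> 1" for x
    using Q[of x] log_cut_le_1[of n "Q x"] n Q_ge_1[of x] by (simp add: psi_def)
  have psi1: "psi x \<le> 1" for x
    using psiQ[of x] mult_left_mono[OF Q_ge_1[of x] psi0[of x]] by linarith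
  have th: "0 \<le> (psi x)\<^sup>2" "(psi x)\<^sup>2 \<le> 1" "(psi x)\<^sup>2 \<noteq> 0 \<Longrightarrow> Q x \<le> exp n" for x
    using psi0[of x] psi1[of x] log_cut_support[of n "Q x"] n Q_ge_1[of x]
    by (auto simp: power_le_one psi_def)
  let ?E = "\<lambda>x y. (u x - u y) * (of_real ((psi x)\<^sup>2) * cnj (u x) - of_real ((psi y)\<^sup>2) * cnj (u y))"
  define S where "S = (\<Sum>\<^sub>\<infinity>x. lap u x * (of_real ((psi x)\<^sup>2) * cnj (u x)))"
  have E: "((\<lambda>(x, y). complex_of_real (b x y) * ?E x y) has_sum (2 * S)) UNIV"
    unfolding S_def by (rule localized_green_has_sum[OF th])
  have sm: "(\<lambda>x. lap u x * (of_real ((psi x)\<^sup>2) * cnj (u x))) summable_on UNIV"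
    by (rule localized_green_summable[OF th])
  have ReE: "((\<lambda>(x, y). b x y * Re (?E x y)) has_sum (2 * Re S)) UNIV"
    using has_sum_Re[OF E] by (simp add: case_prod_unfold)
  have "Re S = (\<Sum>\<^sub>\<infinity>x. Re (lap u x * (of_real ((psi x)\<^sup>2) * cnj (u x))))"
    unfolding S_def by (rule infsum_Re[OF sm, symmetric])
  also have "\<dots> \<le> mass"
  proof (rule infsum_mono[OF summable_on_Re[OF sm] u_summable])
    fix x
    have "- V x * (psi x)\<^sup>2 \<le> (Q x)\<^sup>2 * (psi x)\<^sup>2" by (intro mult_right_mono V_ge) simp
    also have "\<dots> = (psi x * Q x)\<^sup>2" by (simp add: power_mult_distrib)
    also have "\<dots> \<le> 1" using psiQ[of x] psi0[of x] Q[of x] by (simp add: power_le_one)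
    finally have "- V x * (psi x)\<^sup>2 * (\<mu> x * (cmod (u x))\<^sup>2) \<le> 1 * (\<mu> x * (cmod (u x))\<^sup>2)"
      using pos[of x] by (intro mult_right_mono) (auto simp: less_imp_le)
    then show "Re (lap u x * (of_real ((psi x)\<^sup>2) * cnj (u x))) \<le> \<mu> x * (cmod (u x))\<^sup>2"
      unfolding lap_eigen using imag by (simp add: mult.assoc)
  qed
  finally have ReS: "Re S \<le> mass" .
  obtain h where h: "h \<le> 2 * K * mass"
    and H: "((\<lambda>(x, y). b x y * (Q x - Q y)\<^sup>2 * ((cmod (u x))\<^sup>2 + (cmod (u y))\<^sup>2)) has_sum h) UNIV"
    using energy_u_has_sum by blast
  let ?G = "\<lambda>(x, y). b x y * (((psi x)\<^sup>2 + (psi y)\<^sup>2) * (cmod (u x - u y))\<^sup>2)"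
  let ?R = "\<lambda>p. 4 * (case p of (x, y) \<Rightarrow> b x y * Re (?E x y))
    + 16 * (case p of (x, y) \<Rightarrow> b x y * (Q x - Q y)\<^sup>2 * ((cmod (u x))\<^sup>2 + (cmod (u y))\<^sup>2))"
  have R: "(?R has_sum (4 * (2 * Re S) + 16 * h)) UNIV"
    by (intro has_sum_add has_sum_cmult_right ReE H)
  have le: "?G p \<le> ?R p" for p
  proof -
    obtain x y where p: "p = (x, y)" by fastforce
    have "\<bar>psi x - psi y\<bar>\<^sup>2 \<le> (2 * \<bar>Q x - Q y\<bar>)\<^sup>2"
      unfolding psi_def by (intro power_mono log_cut_over_id_lipschitz n Q_ge_1) simp
    then have "4 * (psi x - psi y)\<^sup>2 * ((cmod (u x))\<^sup>2 + (cmod (u y))\<^sup>2)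
        \<le> 16 * (Q x - Q y)\<^sup>2 * ((cmod (u x))\<^sup>2 + (cmod (u y))\<^sup>2)"
      by (intro mult_right_mono) (auto simp: power_mult_distrib)
    with energy_density_Re_ge[of "psi x" "psi y" "u x" "u y"]
    have "((psi x)\<^sup>2 + (psi y)\<^sup>2) * (cmod (u x - u y))\<^sup>2
      \<le> 4 * Re (?E x y) + 16 * (Q x - Q y)\<^sup>2 * ((cmod (u x))\<^sup>2 + (cmod (u y))\<^sup>2)" by linarith
    from mult_left_mono[OF this, of "b x y"] show ?thesis
      by (simp add: p distrib_left mult.left_commute mult.assoc del: of_real_power)
  qed
  have "?G summable_on UNIV"
    by (rule summable_on_comparison_test[of ?R]) (use R le in \<open>auto simp: summable_on_def\<close>)
  then have G: "(?G has_sum infsum ?G UNIV) UNIV" by (rule has_sum_infsum)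
  have "infsum ?G UNIV \<le> 4 * (2 * Re S) + 16 * h"
    by (rule has_sum_mono[OF G R le])
  also have "\<dots> \<le> (8 + 32 * K) * mass" using ReS h by (simp add: algebra_simps)
  finally show ?thesis using G unfolding psi_def by blast
qed

text \<open>The imaginary part of Green's formula with the test function \<open>log_cut n Q * cnj u\<close> isolates the mass, since
\<open>V\<close> is real. The remaining gradient term is a product of the weighted gradient of \<open>u\<close>, bounded by
\<open>weighted_energy\<close>, with \<open>u\<close> times the gradient of \<open>Q\<close>, and it carries the factor \<open>1 / n\<close>.\<close>
lemma log_cut_mass_le:
  assumes n: "1 \<le> n"
  shows "\<exists>s\<le>(2 + 9 * K) * mass / n. ((\<lambda>x. log_cut n (Q x) * (\<mu> x * (cmod (u x))\<^sup>2)) has_sum s) UNIV"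
proof -
  define psi where "psi x = log_cut (2 * n) (Q x) / Q x" for x
  have th: "0 \<le> log_cut n (Q x)" "log_cut n (Q x) \<le> 1" "log_cut n (Q x) \<noteq> 0 \<Longrightarrow> Q x \<le> exp n" for x
    using n Q_ge_1[of x] by (auto intro: log_cut_nonneg log_cut_le_1 log_cut_support)
  let ?E = "\<lambda>x y. (u x - u y) * (of_real (log_cut n (Q x)) * cnj (u x) - of_real (log_cut n (Q y)) * cnj (u y))"
  define S where "S = (\<Sum>\<^sub>\<infinity>x. lap u x * (of_real (log_cut n (Q x)) * cnj (u x)))"
  have E: "((\<lambda>(x, y). complex_of_real (b x y) * ?E x y) has_sum (2 * S)) UNIV"
    unfolding S_def by (rule localized_green_has_sum[OF th])
  have sm: "(\<lambda>x. lap u x * (of_real (log_cut n (Q x)) * cnj (u x))) summable_on UNIV"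
    by (rule localized_green_summable[OF th])
  have ImE: "((\<lambda>(x, y). (Im \<kappa> * b x y) * Im (?E x y)) has_sum (Im \<kappa> * (2 * Im S))) UNIV"
    using has_sum_cmult_right[OF has_sum_Im[OF E], of "Im \<kappa>"] by (simp add: case_prod_unfold mult.assoc)
  have kk: "Im \<kappa> * Im \<kappa> = 1" using imag(2) by (metis abs_mult_self_eq mult_1)
  have "((\<lambda>x. Im \<kappa> * Im (lap u x * (of_real (log_cut n (Q x)) * cnj (u x)))) has_sum (Im \<kappa> * Im S)) UNIV"
    unfolding S_def by (intro has_sum_cmult_right has_sum_Im has_sum_infsum sm)
  then have cm: "((\<lambda>x. log_cut n (Q x) * (\<mu> x * (cmod (u x))\<^sup>2)) has_sum (Im \<kappa> * Im S)) UNIV"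
    unfolding lap_eigen using kk by (simp flip: mult.assoc)
  obtain g where g: "g \<le> (8 + 32 * K) * mass"
    and G: "((\<lambda>(x, y). b x y * (((psi x)\<^sup>2 + (psi y)\<^sup>2) * (cmod (u x - u y))\<^sup>2)) has_sum g) UNIV"
    using weighted_energy[of "2 * n"] n unfolding psi_def by auto
  obtain h where h: "h \<le> 2 * K * mass"
    and H: "((\<lambda>(x, y). b x y * (Q x - Q y)\<^sup>2 * ((cmod (u x))\<^sup>2 + (cmod (u y))\<^sup>2)) has_sum h) UNIV"
    using energy_u_has_sum by blast
  let ?R = "\<lambda>p. (1 / n) * ((1 / 2) * (case p of (x, y) \<Rightarrow> b x y * (((psi x)\<^sup>2 + (psi y)\<^sup>2) * (cmod (u x - u y))\<^sup>2))
    + (case p of (x, y) \<Rightarrow> b x y * (Q x - Q y)\<^sup>2 * ((cmod (u x))\<^sup>2 + (cmod (u y))\<^sup>2)))"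
  have R: "(?R has_sum ((1 / n) * ((1 / 2) * g + h))) UNIV"
    by (intro has_sum_add has_sum_cmult_right G H)
  have "Im \<kappa> * (2 * Im S) \<le> (1 / n) * ((1 / 2) * g + h)"
  proof (rule has_sum_mono[OF ImE R])
    fix p :: "'a \<times> 'a"
    obtain x y where p: "p = (x, y)" by fastforce
    define s where "s = sqrt ((psi x)\<^sup>2 + (psi y)\<^sup>2)"
    define d where "d = cmod (u x - u y)"
    define a where "a = cmod (u x + u y)"
    define q where "q = \<bar>Q x - Q y\<bar>"
    have a: "a\<^sup>2 \<le> 2 * ((cmod (u x))\<^sup>2 + (cmod (u y))\<^sup>2)"
    proof -
      have "a\<^sup>2 \<le> (cmod (u x) + cmod (u y))\<^sup>2" unfolding a_def by (intro power_mono norm_triangle_ineq) auto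
      also have "\<dots> \<le> 2 * ((cmod (u x))\<^sup>2 + (cmod (u y))\<^sup>2)"
        using sum_squares_bound[of "cmod (u x)" "cmod (u y)"] by (simp add: power2_sum)
      finally show ?thesis .
    qed
    have "Im \<kappa> * Im (?E x y) \<le> \<bar>Im \<kappa> * Im (?E x y)\<bar>" by simp
    also have "\<dots> = \<bar>Im (?E x y)\<bar>" by (simp only: abs_mult imag(2) mult_1)
    also have "\<dots> \<le> \<bar>log_cut n (Q x) - log_cut n (Q y)\<bar> / 2 * (d * a)"
      unfolding d_def a_def by (rule energy_density_Im_le)
    also have "\<dots> \<le> (2 / n * q * s) / 2 * (d * a)"
      unfolding q_def s_def psi_def
      by (intro mult_right_mono divide_right_mono log_cut_lipschitz_weighted n Q_ge_1) (auto simp: d_def a_def)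
    also have "\<dots> = (1 / n) * ((s * d) * (q * a))" by simp
    also have "\<dots> \<le> (1 / n) * (((s * d)\<^sup>2 + (q * a)\<^sup>2) / 2)"
      using sum_squares_bound[of "s * d" "q * a"] n by (intro mult_left_mono) auto
    also have "\<dots> \<le> (1 / n) * ((1 / 2) * (s\<^sup>2 * d\<^sup>2) + q\<^sup>2 * ((cmod (u x))\<^sup>2 + (cmod (u y))\<^sup>2))"
      using mult_left_mono[OF a, of "q\<^sup>2"] n by (intro mult_left_mono) (auto simp: power_mult_distrib distrib_left)
    finally have "Im \<kappa> * Im (?E x y) \<le> (1 / n) * ((1 / 2) * (((psi x)\<^sup>2 + (psi y)\<^sup>2) * d\<^sup>2)
        + (Q x - Q y)\<^sup>2 * ((cmod (u x))\<^sup>2 + (cmod (u y))\<^sup>2))"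
      by (simp add: s_def q_def)
    from mult_left_mono[OF this, of "b x y"]
    show "(case p of (x, y) \<Rightarrow> (Im \<kappa> * b x y) * Im (?E x y)) \<le> ?R p"
      by (simp add: p d_def algebra_simps)
  qed
  also have "(1 / n) * ((1 / 2) * g + h) \<le> (1 / n) * (2 * ((2 + 9 * K) * mass))"
    using g h n by (intro mult_left_mono) (auto simp: algebra_simps)
  finally have "Im \<kappa> * Im S \<le> (2 + 9 * K) * mass / n" by simp
  with cm show ?thesis by blast
qed

text \<open>As \<open>n\<close> grows, the cut-off tends to \<open>1\<close> at every vertex while the mass it captures tends to \<open>0\<close>.\<close>
lemma deficiency_zero: "u = (\<lambda>x. 0)"
proof
  fix x
  let ?m = "\<mu> x * (cmod (u x))\<^sup>2"
  have le: "log_cut (real (Suc n)) (Q x) * ?m \<le> (2 + 9 * K) * mass * (1 / real (Suc n))" for n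
  proof -
    obtain s where s: "s \<le> (2 + 9 * K) * mass / real (Suc n)"
      "((\<lambda>x. log_cut (real (Suc n)) (Q x) * (\<mu> x * (cmod (u x))\<^sup>2)) has_sum s) UNIV"
      using log_cut_mass_le[of "real (Suc n)"] by auto
    have "(\<Sum>x\<in>{x}. log_cut (real (Suc n)) (Q x) * (\<mu> x * (cmod (u x))\<^sup>2)) \<le> s"
      by (rule finite_sum_le_has_sum[OF s(2)]) (auto simp: log_cut_nonneg pos less_imp_le)
    with s(1) show ?thesis by simp
  qed
  have "1 * ?m \<le> (2 + 9 * K) * mass * 0"
  proof (rule LIMSEQ_le)
    show "(\<lambda>n. log_cut (real (Suc n)) (Q x) * ?m) \<longlonglongrightarrow> 1 * ?m"
      by (intro tendsto_intros log_cut_tendsto_1)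
    show "(\<lambda>n. (2 + 9 * K) * mass * (1 / real (Suc n))) \<longlonglongrightarrow> (2 + 9 * K) * mass * 0"
      by (intro tendsto_intros LIMSEQ_Suc[OF lim_1_over_n])
  qed (intro exI[of _ 0] allI impI le)
  then show "u x = 0" using pos[of x] by (simp add: mult_le_0_iff)
qed

end

end

end

section \<open>An exhaustion function from the metric and the potential\<close>

lemma
  fixes f :: "'b \<Rightarrow> real"
  assumes le: "(\<Sum>\<^sub>\<infinity>y. ennreal (f y)) \<le> ennreal c" and nonneg: "\<And>y. 0 \<le> f y" "0 \<le> c"
  shows summable_on_of_ennreal_infsum_le: "f summable_on UNIV"
    and infsum_le_of_ennreal_infsum_le: "infsum f UNIV \<le> c"
proof -
  have fin: "sum f F \<le> c" if F: "finite F" for F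
  proof -
    have "ennreal (sum f F) = (\<Sum>\<^sub>\<infinity>y\<in>F. ennreal (f y))" using F nonneg by (simp add: sum_ennreal)
    also have "\<dots> \<le> (\<Sum>\<^sub>\<infinity>y. ennreal (f y))" 
      by (rule infsum_mono_neutral) (auto intro!: nonneg_summable_on_complete)
    finally have "ennreal (sum f F) \<le> ennreal c" using le by (rule order_trans)
    then show ?thesis using nonneg(2) by (simp add: ennreal_le_iff)
  qed
  show "f summable_on UNIV" by (rule nonneg_summable_of_bounded_sums(1)[OF nonneg(1) fin])
  show "infsum f UNIV \<le> c" by (rule nonneg_summable_of_bounded_sums(2)[OF nonneg(1) fin])
qed

lemma sqrt_diff_square_le:
  fixes s t :: real
  assumes "0 \<le> s" "0 \<le> t"
  shows "(sqrt (1 + s) - sqrt (1 + t))\<^sup>2 \<le> (s - t)\<^sup>2 / (1 + s)"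
proof -
  have "(s - t)\<^sup>2 = ((sqrt (1 + s) - sqrt (1 + t)) * (sqrt (1 + s) + sqrt (1 + t)))\<^sup>2"
    using assms by (simp add: algebra_simps)
  also have "\<dots> \<ge> (sqrt (1 + s) - sqrt (1 + t))\<^sup>2 * (sqrt (1 + s))\<^sup>2"
    unfolding power_mult_distrib using assms by (intro mult_left_mono power_mono) auto
  finally show ?thesis using assms by (simp add: field_simps)
qed

theorem theorem2p1:
  fixes b :: "'a::countable \<Rightarrow> 'a \<Rightarrow> real"
    and \<mu> V U W :: "'a \<Rightarrow> real"
    and c1 c2 :: real
  assumes graph: "weighted_graph b"
    and conn: "connected_graph b"
    and mu_pos: "\<And>x. \<mu> x > 0"
    and FC: "finiteness_condition b \<mu>"
    and B_star: "\<exists>\<rho>. pseudo_metric \<rho> \<and> intrinsic b \<mu> \<rho> \<and> degree_bounded_on_balls b \<mu> \<rho>"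
    and V: "\<And>x. V x = U x - W x"
    and U_nonneg: "\<And>x. U x \<ge> 0"
    and W_nonneg: "\<And>x. W x \<ge> 0"
    and c_nonneg: "c1 \<ge> 0" "c2 \<ge> 0"
    and grad_W: "\<And>x. grad_sq b \<mu> (\<lambda>y. complex_of_real (W y)) x \<le> ennreal (c1 + c2 * W x)"
  shows "essentially_self_adjoint \<mu> (restrict_op (schroedinger b \<mu> V) finsupp_funs)"
proof -
  interpret graph_space \<mu> b by unfold_locales (rule mu_pos graph)+
  obtain \<rho> where metric: "pseudo_metric \<rho>" and intr: "intrinsic b \<mu> \<rho>"
    and deg_bdd: "degree_bounded_on_balls b \<mu> \<rho>" using B_star by blast
  have rho: "0 \<le> \<rho> x y" "\<rho> x y = \<rho> y x" "\<rho> x z \<le> \<rho> x y + \<rho> y z" for x y z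
    using metric by (auto simp: pseudo_metric_def)
  have rho_sum: "(\<lambda>y. b x y * (\<rho> x y)\<^sup>2) summable_on UNIV" "(\<Sum>\<^sub>\<infinity>y. b x y * (\<rho> x y)\<^sup>2) \<le> \<mu> x" for x
  proof -
    have le: "(\<Sum>\<^sub>\<infinity>y. ennreal (b x y * (\<rho> x y)\<^sup>2)) \<le> ennreal (\<mu> x)"
      using intr by (simp add: intrinsic_def)
    show "(\<lambda>y. b x y * (\<rho> x y)\<^sup>2) summable_on UNIV" "(\<Sum>\<^sub>\<infinity>y. b x y * (\<rho> x y)\<^sup>2) \<le> \<mu> x"
      using summable_on_of_ennreal_infsum_le[OF le] infsum_le_of_ennreal_infsum_le[OF le] mu_pos[of x]
      by (simp_all add: less_imp_le)
  qed
  have W_sum: "(\<lambda>y. b x y * (W x - W y)\<^sup>2) summable_on UNIV"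
    "(\<Sum>\<^sub>\<infinity>y. b x y * (W x - W y)\<^sup>2) \<le> \<mu> x * (c1 + c2 * W x)" for x
  proof -
    have nonneg: "0 \<le> c1 + c2 * W x" using c_nonneg W_nonneg[of x] by simp
    have "(cmod (complex_of_real (W x) - complex_of_real (W y)))\<^sup>2 = (W x - W y)\<^sup>2" for y
      by (simp flip: of_real_diff)
    then have "ennreal (1 / \<mu> x) * (\<Sum>\<^sub>\<infinity>y. ennreal (b x y * (W x - W y)\<^sup>2)) \<le> ennreal (c1 + c2 * W x)"
      using grad_W[of x] by (simp add: grad_sq_def)
    from mult_left_mono[OF this, of "ennreal (\<mu> x)"]
    have "ennreal (\<mu> x * (1 / \<mu> x)) * (\<Sum>\<^sub>\<infinity>y. ennreal (b x y * (W x - W y)\<^sup>2)) \<le> ennreal (\<mu> x * (c1 + c2 * W x))"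
      using mu_pos[of x] nonneg by (simp add: ennreal_mult mult.assoc less_imp_le del: times_divide_eq_right)
    then have le: "(\<Sum>\<^sub>\<infinity>y. ennreal (b x y * (W x - W y)\<^sup>2)) \<le> ennreal (\<mu> x * (c1 + c2 * W x))"
      using mu_pos[of x] by simp
    have "0 \<le> \<mu> x * (c1 + c2 * W x)" using nonneg mu_pos[of x] by (simp add: less_imp_le)
    then show "(\<lambda>y. b x y * (W x - W y)\<^sup>2) summable_on UNIV"
      "(\<Sum>\<^sub>\<infinity>y. b x y * (W x - W y)\<^sup>2) \<le> \<mu> x * (c1 + c2 * W x)"
      using summable_on_of_ennreal_infsum_le[OF le] infsum_le_of_ennreal_infsum_le[OF le] by simp_all
  qed
  define z :: 'a where "z = undefined"
  (* Both summands have energy bounded by mu: the metric because it is intrinsic, the square root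
     by the gradient bound on W, since its increments are at most those of W divided by sqrt (1 + W x). *)
  define Q where "Q x = sqrt (1 + W x) + \<rho> z x" for x
  define K where "K = 2 * (c1 + c2) + 2"
  have Q_sq: "(Q x - Q y)\<^sup>2 \<le> 2 * (1 / (1 + W x)) * (W x - W y)\<^sup>2 + 2 * (\<rho> x y)\<^sup>2" for x y
  proof -
    have "\<bar>\<rho> z x - \<rho> z y\<bar> \<le> \<rho> x y" using rho(3)[of z x y] rho(3)[of z y x] rho(2)[of x y] by linarith
    then have "(\<rho> z x - \<rho> z y)\<^sup>2 \<le> (\<rho> x y)\<^sup>2" by (simp add: abs_le_square_iff[symmetric] rho(1))
    moreover have "(Q x - Q y)\<^sup>2 \<le> 2 * (sqrt (1 + W x) - sqrt (1 + W y))\<^sup>2 + 2 * (\<rho> z x - \<rho> z y)\<^sup>2"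
    proof -
      have "(p + q)\<^sup>2 \<le> 2 * p\<^sup>2 + 2 * q\<^sup>2" for p q :: real
        using sum_squares_bound[of p q] by (simp add: power2_sum)
      from this[of "sqrt (1 + W x) - sqrt (1 + W y)" "\<rho> z x - \<rho> z y"] show ?thesis
        by (simp add: Q_def algebra_simps)
    qed
    ultimately show ?thesis using sqrt_diff_square_le[OF W_nonneg[of x] W_nonneg[of y]] by simp
  qed
  have majorant: "((\<lambda>y. 2 * (1 / (1 + W x)) * (b x y * (W x - W y)\<^sup>2) + 2 * (b x y * (\<rho> x y)\<^sup>2)) has_sum
     (2 * (1 / (1 + W x)) * (\<Sum>\<^sub>\<infinity>y. b x y * (W x - W y)\<^sup>2) + 2 * (\<Sum>\<^sub>\<infinity>y. b x y * (\<rho> x y)\<^sup>2))) UNIV" for x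
    by (intro has_sum_add has_sum_cmult_right has_sum_infsum W_sum rho_sum)
  have Q_le: "b x y * (Q x - Q y)\<^sup>2 \<le> 2 * (1 / (1 + W x)) * (b x y * (W x - W y)\<^sup>2) + 2 * (b x y * (\<rho> x y)\<^sup>2)" for x y
    using mult_left_mono[OF Q_sq[of x y], of "b x y"] by (simp add: algebra_simps)
  interpret exhausted_graph \<mu> b Q K
  proof
    fix x
    have "1 \<le> sqrt (1 + W x)" using W_nonneg[of x] by simp
    then show "1 \<le> Q x" unfolding Q_def using rho(1)[of z x] by linarith
    show s: "(\<lambda>y. b x y * (Q x - Q y)\<^sup>2) summable_on UNIV"
      by (rule summable_on_comparison_test[OF has_sum_imp_summable[OF majorant[of x]] Q_le]) simp
    have "(\<Sum>\<^sub>\<infinity>y. b x y * (Q x - Q y)\<^sup>2)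
        \<le> 2 * (1 / (1 + W x)) * (\<Sum>\<^sub>\<infinity>y. b x y * (W x - W y)\<^sup>2) + 2 * (\<Sum>\<^sub>\<infinity>y. b x y * (\<rho> x y)\<^sup>2)"
      by (rule has_sum_mono[OF has_sum_infsum[OF s] majorant Q_le])
    also have "\<dots> \<le> 2 * (1 / (1 + W x)) * (\<mu> x * ((c1 + c2) * (1 + W x))) + 2 * \<mu> x"
    proof -
      have "c1 + c2 * W x \<le> (c1 + c2) * (1 + W x)" using c_nonneg W_nonneg[of x] by (simp add: algebra_simps)
      from mult_left_mono[OF this, of "\<mu> x"] W_sum(2)[of x] mu_pos[of x]
      have "(\<Sum>\<^sub>\<infinity>y. b x y * (W x - W y)\<^sup>2) \<le> \<mu> x * ((c1 + c2) * (1 + W x))" by linarith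
      then show ?thesis using rho_sum(2)[of x] W_nonneg[of x] by (intro add_mono mult_left_mono) auto
    qed
    also have "\<dots> = K * \<mu> x" using W_nonneg[of x] by (simp add: K_def field_simps)
    finally show "(\<Sum>\<^sub>\<infinity>y. b x y * (Q x - Q y)\<^sup>2) \<le> K * \<mu> x" .
  next
    fix r
    have "bounded (weighted_degree b \<mu> ` metric_ball \<rho> z (max r 0))"
      using deg_bdd by (simp add: degree_bounded_on_balls_def)
    then obtain D where D: "\<And>x. \<rho> z x \<le> max r 0 \<Longrightarrow> \<bar>weighted_degree b \<mu> x\<bar> \<le> D"
      unfolding bounded_iff by (auto simp: metric_ball_def)
    have "deg x \<le> D * \<mu> x" if "Q x \<le> r" for x
    proof -
      have "\<rho> z x \<le> Q x" using W_nonneg[of x] by (simp add: Q_def)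
      then have "\<rho> z x \<le> max r 0" using that by linarith
      then have "weighted_degree b \<mu> x \<le> D" using D[of x] by linarith
      then show ?thesis using mu_pos[of x] by (simp add: weighted_degree_def deg_def field_simps)
    qed
    then show "\<exists>D. \<forall>x. Q x \<le> r \<longrightarrow> deg x \<le> D * \<mu> x" by blast
  qed
  have V_ge: "- V x \<le> (Q x)\<^sup>2" for x
  proof -
    have "- V x \<le> 1 + W x" using V[of x] U_nonneg[of x] by simp
    also have "\<dots> = (sqrt (1 + W x))\<^sup>2" using W_nonneg[of x] by simp
    also have "\<dots> \<le> (Q x)\<^sup>2" unfolding Q_def using W_nonneg[of x] rho(1) by (intro power_mono) auto
    finally show ?thesis .
  qed
  show ?thesis
  proof (rule essentially_self_adjointI[OF schroedinger_symmetric[OF FC]])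
    fix u :: "'a \<Rightarrow> complex"
    let ?T = "restrict_op (schroedinger b \<mu> V) finsupp_funs"
    show "u = (\<lambda>x. 0)" if "(u, (\<lambda>x. \<i> * u x)) \<in> adjoint_op \<mu> ?T"
      by (rule deficiency_zero[OF adjoint_opD(1)[OF that] V_ge adjoint_schroedinger[OF FC that, symmetric]]) auto
    show "u = (\<lambda>x. 0)" if "(u, (\<lambda>x. - \<i> * u x)) \<in> adjoint_op \<mu> ?T"
      by (rule deficiency_zero[OF adjoint_opD(1)[OF that] V_ge adjoint_schroedinger[OF FC that, symmetric]]) auto
  qed
qed

end
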